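(* Let $\alpha\in\mathbb{R}$. Up to a linear isometry and a dilation of $\mathbb{L}^2$, the $\alpha$-stationary spacelike curves contained in $\mathcal{C}^-$ are parametrized by $\gamma(s)=\rho(s)(\sinh s,\cosh s)$, where $$\rho(s)=\begin{cases}\cosh((\alpha-1)s)^{\frac{1}{\alpha-1}}, & \alpha\neq 1,\\ e^{cs}, & \alpha=1,\ c^2<1\ (c\in\mathbb{R}\text{ constant}).\end{cases}$$ Moreover, for these curves: (1) If $\alpha>1$, then the two branches of $\gamma$ are asymptotic to a vertical translation of the lightlike cone $\mathcal{C}$. (2) If $\alpha=1$, then $\gamma$ is a hyperbolic circle $\mathbb{H}^1(r)$ centered at the origin or the two branches of $\gamma$ are asymptotic to $\mathcal{C}$. (3) If $0<\alpha<1$, then $\gamma$ meets $\mathcal{C}$ tangentially at two points. (4) If $\alpha<0$, then $\gamma$ intersects $\mathcal{C}$ orthogonally at two points.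
   Context: $\mathbb{L}^2=(\mathbb{R}^2,\langle\cdot,\cdot\rangle)$ with $\langle\cdot,\cdot\rangle=dx^2-dy^2$. $\mathcal{C}=\{p\in\mathbb{L}^2:\langle p,p\rangle=0\}$ is the lightlike cone, $\mathcal{C}^-=\{p:\langle p,p\rangle<0\}$, $\mathcal{C}^+=\{p:\langle p,p\rangle>0\}$. A smooth regular curve is spacelike (resp. timelike) if $\langle\gamma',\gamma'\rangle>0$ (resp. $<0$) everywhere. Let $N$ be a unit normal field along $\gamma$ ($\langle N,\gamma'\rangle=0$, $|\langle N,N\rangle|=1$). When $\gamma$ is parametrized by arc-length ($|\langle\gamma',\gamma'\rangle|=1$) its curvature is $\kappa=-\langle N,\gamma''\rangle$. A spacelike or timelike curve $\gamma\colon I\to\mathbb{L}^2$ with $\gamma(I)\cap\mathcal{C}=\emptyset$ is called $\alpha$-stationary if $\kappa=-\alpha\,\dfrac{\langle N,\gamma\rangle}{|\langle\gamma,\gamma\rangle|}$ along $\gamma$ (this condition does not depend on the choice of sign of $N$). A hyperbolic circle $\mathbb{H}^1(r)$, $r>0$, is one of the two components of $\{p:\langle p,p\rangle=-r^2\}$. A dilation is a map $p\mapsto\lambda p$, $\lambda>0$. The classification is of curves with maximal domain (here $s\in\mathbb{R}$); other stationary curves are arcs of these. The two branches are the ends $s\to\pm\infty$. Being asymptotic to a translated cone $(0,b)+\mathcal{C}$ means that each end goes to infinity approaching one of the lines $y=\pm x+b$. "Meets/intersects $\mathcal{C}$" is understood in the limit: $\gamma(s)$ tends as $s\to\pm\infty$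 to a nonzero point of $\mathcal{C}$, and the contact is tangential (resp. orthogonal) if the limit of the tangent direction is that of the line of $\mathcal{C}$ through the limit point (resp. is perpendicular to it in the Euclidean sense). *)

theory Defs
  imports "HOL-Analysis.Analysis"
begin

text \<open>The Lorentz-Minkowski plane \<open>(\<real>\<^sup>2, dx\<^sup>2 - dy\<^sup>2)\<close> lives on the type \<open>real \<times> real\<close>. The norm, the
  topology and \<open>\<bullet>\<close> on that type are Euclidean.\<close>

definition lor :: "real \<times> real \<Rightarrow> real \<times> real \<Rightarrow> real" where
  "lor p q = fst p * fst q - snd p * snd q"

definition light_cone :: "(real \<times> real) set" where
  "light_cone = {p. lor p p = 0}"

definition cone_minus :: "(real \<times> real) set" where
  "cone_minus = {p. lor p p < 0}"

text \<open>Since \<open>lor\<close> is nondegenerate, such a map is automatically bijective.\<close>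

definition linear_isometry :: "(real \<times> real \<Rightarrow> real \<times> real) \<Rightarrow> bool" where
  "linear_isometry A \<longleftrightarrow> linear A \<and> (\<forall>p q. lor (A p) (A q) = lor p q)"

text \<open>Curves are total functions restricted to an open interval; because the interval is open, the
  two-sided derivatives below do not depend on values outside it.\<close>

definition open_interval :: "real set \<Rightarrow> bool" where
  "open_interval I \<longleftrightarrow> open I \<and> is_interval I \<and> I \<noteq> {}"

definition vderiv :: "(real \<Rightarrow> 'a::real_normed_vector) \<Rightarrow> real \<Rightarrow> 'a" where
  "vderiv f t = vector_derivative f (at t)"

definition smooth_on :: "(real \<Rightarrow> 'a::real_normed_vector) \<Rightarrow> real set \<Rightarrow> bool" where
  "smooth_on f I \<longleftrightarrow> (\<forall>k. \<forall>t\<in>I. (vderiv ^^ k) f differentiable (at t))"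

definition regular_on :: "(real \<Rightarrow> 'a::real_normed_vector) \<Rightarrow> real set \<Rightarrow> bool" where
  "regular_on f I \<longleftrightarrow> smooth_on f I \<and> (\<forall>t\<in>I. vderiv f t \<noteq> 0)"

definition spacelike :: "(real \<Rightarrow> real \<times> real) \<Rightarrow> real set \<Rightarrow> bool" where
  "spacelike \<gamma> I \<longleftrightarrow> regular_on \<gamma> I \<and> (\<forall>t\<in>I. lor (vderiv \<gamma> t) (vderiv \<gamma> t) > 0)"

definition timelike :: "(real \<Rightarrow> real \<times> real) \<Rightarrow> real set \<Rightarrow> bool" where
  "timelike \<gamma> I \<longleftrightarrow> regular_on \<gamma> I \<and> (\<forall>t\<in>I. lor (vderiv \<gamma> t) (vderiv \<gamma> t) < 0)"

definition unit_normal :: "(real \<Rightarrow> real \<times> real) \<Rightarrow> (real \<Rightarrow> real \<times> real) \<Rightarrow> real set \<Rightarrow> bool" where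
  "unit_normal N \<gamma> I \<longleftrightarrow> smooth_on N I \<and>
     (\<forall>t\<in>I. lor (N t) (vderiv \<gamma> t) = 0 \<and> \<bar>lor (N t) (N t)\<bar> = 1)"

definition arc_length_param :: "(real \<Rightarrow> real \<times> real) \<Rightarrow> real set \<Rightarrow> bool" where
  "arc_length_param \<gamma> I \<longleftrightarrow> (\<forall>t\<in>I. \<bar>lor (vderiv \<gamma> t) (vderiv \<gamma> t)\<bar> = 1)"

text \<open>Meaningful only for curves parametrized by arc length.\<close>

definition curvature :: "(real \<Rightarrow> real \<times> real) \<Rightarrow> (real \<Rightarrow> real \<times> real) \<Rightarrow> real \<Rightarrow> real" where
  "curvature N \<gamma> t = - lor (N t) (vderiv (vderiv \<gamma>) t)"

text \<open>On an interval, a real function that is \<open>regular_on\<close> is a diffeomorphism onto its image, so it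
  serves as a change of parameter. A curve is tested for stationarity in an arc-length
  parametrization \<open>\<gamma> \<circ> h\<close>; the condition does not depend on the choice of \<open>h\<close> and \<open>N\<close>.\<close>

definition stationary :: "real \<Rightarrow> (real \<Rightarrow> real \<times> real) \<Rightarrow> real set \<Rightarrow> bool" where
  "stationary \<alpha> \<gamma> I \<longleftrightarrow>
     (spacelike \<gamma> I \<or> timelike \<gamma> I) \<and> \<gamma> ` I \<inter> light_cone = {} \<and>
     (\<exists>h J N. open_interval J \<and> regular_on h J \<and> h ` J = I \<and>
        arc_length_param (\<gamma> \<circ> h) J \<and> unit_normal N (\<gamma> \<circ> h) J \<and>
        (\<forall>s\<in>J. curvature N (\<gamma> \<circ> h) s =
           - \<alpha> * (lor (N s) ((\<gamma> \<circ> h) s) / \<bar>lor ((\<gamma> \<circ> h) s) ((\<gamma> \<circ> h) s)\<bar>)))"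

text \<open>Maximal domain: the curve is not a proper arc, up to a change of parameter \<open>\<phi>\<close>, of another
  stationary curve.\<close>

definition maximal_stationary :: "real \<Rightarrow> (real \<Rightarrow> real \<times> real) \<Rightarrow> real set \<Rightarrow> bool" where
  "maximal_stationary \<alpha> \<gamma> I \<longleftrightarrow> stationary \<alpha> \<gamma> I \<and>
     (\<forall>\<delta> J \<phi>. open_interval J \<and> stationary \<alpha> \<delta> J \<and> regular_on \<phi> I \<and> \<phi> ` I \<subseteq> J \<and>
        (\<forall>t\<in>I. \<gamma> t = \<delta> (\<phi> t)) \<longrightarrow> \<phi> ` I = J)"

text \<open>The parameter \<open>c\<close> plays a role only for \<open>\<alpha> = 1\<close>.\<close>

definition profile :: "real \<Rightarrow> real \<Rightarrow> real \<Rightarrow> real" where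
  "profile \<alpha> c s =
     (if \<alpha> = 1 then exp (c * s) else cosh ((\<alpha> - 1) * s) powr (1 / (\<alpha> - 1)))"

definition model_curve :: "real \<Rightarrow> real \<Rightarrow> real \<Rightarrow> real \<times> real" where
  "model_curve \<alpha> c s = profile \<alpha> c s *\<^sub>R (sinh s, cosh s)"

definition hyperbolic_circle :: "real \<Rightarrow> (real \<times> real) set \<Rightarrow> bool" where
  "hyperbolic_circle r H \<longleftrightarrow> r > 0 \<and> H \<in> components {p. lor p p = - r\<^sup>2}"

text \<open>For curves defined on all of \<open>\<real>\<close>, a branch is one of the filters \<open>at_bot\<close>, \<open>at_top\<close>.\<close>

definition asymptotic_branch :: "(real \<Rightarrow> real \<times> real) \<Rightarrow> real filter \<Rightarrow> (real \<times> real) set \<Rightarrow> bool" where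
  "asymptotic_branch \<gamma> F L \<longleftrightarrow>
     filterlim (\<lambda>s. norm (\<gamma> s)) at_top F \<and> ((\<lambda>s. infdist (\<gamma> s) L) \<longlongrightarrow> 0) F"

text \<open>Asymptotic to \<open>(0, b) + light_cone\<close>, the union of the lines \<open>y = x + b\<close> and \<open>y = - x + b\<close>.\<close>

definition asymptotic_to_cone :: "(real \<Rightarrow> real \<times> real) \<Rightarrow> real \<Rightarrow> bool" where
  "asymptotic_to_cone \<gamma> b \<longleftrightarrow>
     (\<forall>F\<in>{at_bot, at_top}. \<exists>\<sigma>\<in>{1, - 1}. asymptotic_branch \<gamma> F {(x, y). y = \<sigma> * x + b})"

text \<open>\<open>v\<close> is the limit of the Euclidean unit tangent vectors along the branch \<open>F\<close>.\<close>

definition limit_tangent :: "(real \<Rightarrow> real \<times> real) \<Rightarrow> real filter \<Rightarrow> real \<times> real \<Rightarrow> bool" where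
  "limit_tangent \<gamma> F v \<longleftrightarrow> norm v = 1 \<and> ((\<lambda>s. sgn (vderiv \<gamma> s)) \<longlongrightarrow> v) F"

definition meets_cone_at :: "(real \<Rightarrow> real \<times> real) \<Rightarrow> real filter \<Rightarrow> real \<times> real \<Rightarrow> bool" where
  "meets_cone_at \<gamma> F p \<longleftrightarrow> p \<in> light_cone \<and> p \<noteq> 0 \<and> (\<gamma> \<longlongrightarrow> p) F"

text \<open>The line of the cone through \<open>p \<noteq> 0\<close> is \<open>span {p}\<close>.\<close>

definition meets_cone_tangentially_at ::
    "(real \<Rightarrow> real \<times> real) \<Rightarrow> real filter \<Rightarrow> real \<times> real \<Rightarrow> bool" where
  "meets_cone_tangentially_at \<gamma> F p \<longleftrightarrow>
     meets_cone_at \<gamma> F p \<and> (\<exists>v. limit_tangent \<gamma> F v \<and> v \<in> span {p})"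

definition meets_cone_orthogonally_at ::
    "(real \<Rightarrow> real \<times> real) \<Rightarrow> real filter \<Rightarrow> real \<times> real \<Rightarrow> bool" where
  "meets_cone_orthogonally_at \<gamma> F p \<longleftrightarrow>
     meets_cone_at \<gamma> F p \<and> (\<exists>v. limit_tangent \<gamma> F v \<and> (\<forall>w\<in>span {p}. v \<bullet> w = 0))"

end

theory Submission
  imports Defs
begin

text \<open>
  In the null coordinates \<open>p = x + y\<close>, \<open>q = x - y\<close> the Lorentzian product is \<open>\<langle>v, v\<rangle> = p q\<close>, and a
  curve in \<open>cone_minus\<close>, where \<open>p q < 0\<close>, is written \<open>\<plusminus> e\<^sup>w (sinh \<phi>, cosh \<phi>)\<close> with
  \<open>\<phi> = ln \<bar>p / q\<bar> / 2\<close> and \<open>w = ln \<bar>p q\<bar> / 2\<close>. Being spacelike means \<open>\<phi>'\<^sup>2 > w'\<^sup>2\<close>, so \<open>\<phi>\<close> is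
  a parameter and the slope \<open>u = dw/d\<phi>\<close> lies in \<open>(-1, 1)\<close>. Free of any choice of normal or
  parametrization, the stationarity condition is an equation of second order in \<open>\<gamma>\<close>
  (\<open>stationary_at\<close>); along the curve it becomes the Riccati equation
  \<open>du/d\<phi> = (\<alpha> - 1) (1 - u\<^sup>2)\<close>, whose solutions in \<open>(-1, 1)\<close> are \<open>tanh ((\<alpha> - 1) \<phi> + \<kappa>)\<close>. If
  \<open>\<alpha> \<noteq> 1\<close>, a translation of \<open>\<phi>\<close>, which is a hyperbolic rotation of the plane, absorbs \<open>\<kappa>\<close>; if
  \<open>\<alpha> = 1\<close>, the slope is the constant \<open>c = tanh \<kappa>\<close>. Integrating \<open>u\<close> gives the logarithm of the
  profile up to an additive constant, that is, up to a dilation. This is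
  \<open>spacelike_stationary_polar\<close> and \<open>spacelike_stationary_is_scaled_model\<close>; read backwards, the same
  computation shows that the models are stationary (\<open>riccati_curve_stationary\<close>).

  The models are maximal because their parameter is the hyperbolic angle, a continuous function on
  all of \<open>cone_minus\<close>: if a model is an arc of \<open>\<delta>\<close>, then the angle along \<open>\<delta>\<close> is a continuous left
  inverse of the change of parameter, which makes the arc open and closed in \<open>\<delta>\<close>.

  For the behaviour at the ends, \<open>\<rho>(s) exp (- s)\<close> (if \<open>\<alpha> > 1\<close>) or \<open>\<rho>(s) exp s\<close> (if \<open>\<alpha> < 1\<close>) tends to
  \<open>(1/2)\<close> to the power \<open>1/(\<alpha> - 1)\<close> as \<open>s \<rightarrow> \<infinity>\<close>; the first limit is the height of the translated cone, the
  second one places the limit point on the cone. For \<open>\<alpha> \<noteq> 1\<close> the velocity is a positive multiple of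
  \<open>(cosh (\<alpha> s), sinh (\<alpha> s))\<close> (\<open>vderiv_model_curve_cosh_sinh\<close>), so its limit direction at
  either end depends only on the sign of \<open>\<alpha>\<close>.
\<close>

section \<open>Smooth functions on open sets\<close>

lemma vderivI: "(f has_vector_derivative D) (at t) \<Longrightarrow> vderiv f t = D"
  by (simp add: vderiv_def vector_derivative_at)

lemma has_vderiv: "f differentiable (at t) \<Longrightarrow> (f has_vector_derivative vderiv f t) (at t)"
  by (simp add: vderiv_def vector_derivative_works)

text \<open>
  Smoothness quantifies over all iterated derivatives, and a formula for all of them at once is
  unwieldy for products and compositions. Counting the derivatives, with the recursion taken at the
  first derivative instead of the last one, makes every closure property an induction on the count
  that uses only the rule for a single derivative.
\<close>

primrec times_diff_on :: "nat \<Rightarrow> (real \<Rightarrow> 'a::real_normed_vector) \<Rightarrow> real set \<Rightarrow> bool" where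
  "times_diff_on 0 f I \<longleftrightarrow> True"
| "times_diff_on (Suc k) f I \<longleftrightarrow> (\<forall>t\<in>I. f differentiable (at t)) \<and> times_diff_on k (vderiv f) I"

lemma times_diff_on_iff:
  "times_diff_on k f I \<longleftrightarrow> (\<forall>j<k. \<forall>t\<in>I. (vderiv ^^ j) f differentiable (at t))"
proof (induction k arbitrary: f)
  case (Suc k)
  have "(\<forall>j<Suc k. P j) \<longleftrightarrow> P 0 \<and> (\<forall>j<k. P (Suc j))" for P
    using less_Suc_eq_0_disj by auto
  then show ?case
    by (simp add: Suc funpow_Suc_right del: funpow.simps(2))
qed simp

lemma smooth_on_iff_times_diff_on: "smooth_on f I \<longleftrightarrow> (\<forall>k. times_diff_on k f I)"
  unfolding smooth_on_def times_diff_on_iff by blast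

lemma smooth_on_vderiv: "smooth_on f I \<Longrightarrow> smooth_on (vderiv f) I"
  unfolding smooth_on_iff_times_diff_on using times_diff_on.simps(2) by blast

lemma smooth_on_has_vderiv:
  "smooth_on f I \<Longrightarrow> t \<in> I \<Longrightarrow> (f has_vector_derivative vderiv f t) (at t)"
  unfolding smooth_on_iff_times_diff_on using times_diff_on.simps(2) has_vderiv by blast

lemma smooth_on_continuous_on: "smooth_on f I \<Longrightarrow> continuous_on I f"
  by (meson continuous_at_imp_continuous_on has_vector_derivative_continuous smooth_on_has_vderiv)

lemma times_diff_on_antimono: "times_diff_on (Suc k) f I \<Longrightarrow> times_diff_on k f I"
  by (simp add: times_diff_on_iff)

lemma has_vector_derivative_cong_open:
  assumes "open I" "t \<in> I" "\<And>t. t \<in> I \<Longrightarrow> f t = g t"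
  shows "(f has_vector_derivative D) (at t) \<longleftrightarrow> (g has_vector_derivative D) (at t)"
  using assms has_vector_derivative_transform_within_open[of f D t I g]
    has_vector_derivative_transform_within_open[of g D t I f] by auto

lemma vderiv_cong:
  assumes "open I" "t \<in> I" "\<And>t. t \<in> I \<Longrightarrow> f t = g t"
  shows "vderiv f t = vderiv g t"
  unfolding vderiv_def vector_derivative_def
  using has_vector_derivative_cong_open[OF assms] by simp

lemma times_diff_on_cong:
  assumes "open I" "\<And>t. t \<in> I \<Longrightarrow> f t = g t" "times_diff_on k f I"
  shows "times_diff_on k g I"
  using assms(2,3)
proof (induction k arbitrary: f g)
  case (Suc k)
  have "g differentiable (at t)" if "t \<in> I" for t
  proof -
    have "(f has_vector_derivative vderiv f t) (at t)"
      using Suc.prems(2) that has_vderiv by auto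
    then show ?thesis
      using has_vector_derivative_cong_open[OF assms(1) that, of f g "vderiv f t"] Suc.prems(1)
      by (blast intro: differentiableI_vector)
  qed
  moreover have "times_diff_on k (vderiv g) I"
    using Suc.IH[of "vderiv f" "vderiv g"] vderiv_cong[OF assms(1), of _ f g] Suc.prems by auto
  ultimately show ?case by simp
qed simp

lemma smooth_on_cong:
  "open I \<Longrightarrow> smooth_on f I \<Longrightarrow> (\<And>t. t \<in> I \<Longrightarrow> f t = g t) \<Longrightarrow> smooth_on g I"
  unfolding smooth_on_iff_times_diff_on using times_diff_on_cong by blast

text \<open>
  The step of all inductions below: any function that agrees with the derivative on the open set may
  replace it.
\<close>

lemma times_diff_on_SucI:
  assumes "open I" "\<And>t. t \<in> I \<Longrightarrow> (f has_vector_derivative f' t) (at t)" "times_diff_on k f' I"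
  shows "times_diff_on (Suc k) f I"
proof -
  have "times_diff_on k (vderiv f) I"
    using assms(2) by (intro times_diff_on_cong[OF assms(1) _ assms(3)]) (metis vderivI)
  then show ?thesis
    using assms(2) by (auto intro: differentiableI_vector)
qed

lemma smooth_onI:
  assumes "open I" "\<And>t. t \<in> I \<Longrightarrow> (f has_vector_derivative f' t) (at t)" "smooth_on f' I"
  shows "smooth_on f I"
  using assms times_diff_on_SucI[OF assms(1,2)] times_diff_on_antimono
  unfolding smooth_on_iff_times_diff_on by blast

lemma times_diff_on_const: "times_diff_on k (\<lambda>t. c) I"
proof (induction k arbitrary: c)
  case (Suc k)
  have "vderiv (\<lambda>t. c) = (\<lambda>t. 0)"
    by (auto intro!: ext vderivI derivative_eq_intros)
  then show ?case using Suc by simp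
qed simp

lemma times_diff_on_bounded_linear:
  assumes L: "bounded_linear L" and "open I" "times_diff_on k f I"
  shows "times_diff_on k (\<lambda>t. L (f t)) I"
  using assms(3)
proof (induction k arbitrary: f)
  case (Suc k)
  show ?case
    using Suc by (intro times_diff_on_SucI[OF \<open>open I\<close>, where f' = "\<lambda>t. L (vderiv f t)"])
      (auto intro!: bounded_linear.has_vector_derivative[OF L] has_vderiv)
qed simp

lemma times_diff_on_add:
  assumes "open I" "times_diff_on k f I" "times_diff_on k g I"
  shows "times_diff_on k (\<lambda>t. f t + g t) I"
  using assms(2,3)
proof (induction k arbitrary: f g)
  case (Suc k)
  show ?case
    using Suc
    by (intro times_diff_on_SucI[OF \<open>open I\<close>, where f' = "\<lambda>t. vderiv f t + vderiv g t"])
      (auto intro!: has_vector_derivative_add has_vderiv)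
qed simp

lemma times_diff_on_bilinear:
  assumes B: "bounded_bilinear B" and I: "open I" and "times_diff_on k f I" "times_diff_on k g I"
  shows "times_diff_on k (\<lambda>t. B (f t) (g t)) I"
  using assms(3,4)
proof (induction k arbitrary: f g)
  case (Suc k)
  have "times_diff_on k f I" "times_diff_on k g I"
    using Suc.prems times_diff_on_antimono by blast+
  then have "times_diff_on k (\<lambda>t. B (f t) (vderiv g t) + B (vderiv f t) (g t)) I"
    using Suc.prems by (intro times_diff_on_add I Suc.IH) auto
  then show ?case
    using Suc.prems
    by (intro times_diff_on_SucI[OF I, where f' = "\<lambda>t. B (f t) (vderiv g t) + B (vderiv f t) (g t)"])
      (auto intro!: bounded_bilinear.has_vector_derivative[OF B] has_vderiv)
qed simp

lemma times_diff_on_compose: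
  assumes I: "open I" and "open J" "h ` J \<subseteq> I" "times_diff_on k f I" "times_diff_on k h J"
  shows "times_diff_on k (\<lambda>t. f (h t)) J"
  using assms(4,5)
proof (induction k arbitrary: f)
  case (Suc k)
  have "times_diff_on k h J"
    using Suc.prems times_diff_on_antimono by blast
  then have "times_diff_on k (\<lambda>t. vderiv h t *\<^sub>R vderiv f (h t)) J"
    using Suc.prems
    by (intro times_diff_on_bilinear[OF bounded_bilinear_scaleR] Suc.IH \<open>open J\<close>) auto
  moreover have "((\<lambda>t. f (h t)) has_vector_derivative vderiv h t *\<^sub>R vderiv f (h t)) (at t)"
    if "t \<in> J" for t
    using vector_diff_chain_at[of h "vderiv h t" t f "vderiv f (h t)"] that Suc.prems assms(3)
    by (auto simp: o_def intro!: has_vderiv)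
  ultimately show ?case
    by (intro times_diff_on_SucI[OF \<open>open J\<close>, where f' = "\<lambda>t. vderiv h t *\<^sub>R vderiv f (h t)"])
qed simp

lemma times_diff_on_inverse:
  fixes f :: "real \<Rightarrow> real"
  assumes I: "open I" and "times_diff_on k f I" "\<And>t. t \<in> I \<Longrightarrow> f t \<noteq> 0"
  shows "times_diff_on k (\<lambda>t. inverse (f t)) I"
  using assms(2)
proof (induction k)
  case (Suc k)
  let ?i = "\<lambda>t. inverse (f t)"
  have "times_diff_on k ?i I"
    using Suc.IH Suc.prems times_diff_on_antimono by blast
  then have "times_diff_on k (\<lambda>t. - (?i t * (vderiv f t * ?i t))) I"
    using Suc.prems
    by (intro times_diff_on_bounded_linear[OF bounded_linear_minus[OF bounded_linear_ident]]
        times_diff_on_bilinear[OF bounded_bilinear_mult] I) auto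
  moreover have "(?i has_vector_derivative - (?i t * (vderiv f t * ?i t))) (at t)"
    if "t \<in> I" for t
    using has_vderiv[of f t] assms(3) that Suc.prems
    by (auto simp: has_real_derivative_iff_has_vector_derivative[symmetric]
        intro!: derivative_eq_intros)
  ultimately show ?case
    by (intro times_diff_on_SucI[OF I, where f' = "\<lambda>t. - (?i t * (vderiv f t * ?i t))"])
qed simp

lemma smooth_on_const [simp]: "smooth_on (\<lambda>t. c) I"
  by (simp add: smooth_on_iff_times_diff_on times_diff_on_const)

lemma smooth_on_bounded_linear:
  "bounded_linear L \<Longrightarrow> open I \<Longrightarrow> smooth_on f I \<Longrightarrow> smooth_on (\<lambda>t. L (f t)) I"
  by (simp add: smooth_on_iff_times_diff_on times_diff_on_bounded_linear)

lemma smooth_on_add: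
  "open I \<Longrightarrow> smooth_on f I \<Longrightarrow> smooth_on g I \<Longrightarrow> smooth_on (\<lambda>t. f t + g t) I"
  by (simp add: smooth_on_iff_times_diff_on times_diff_on_add)

lemma smooth_on_minus: "open I \<Longrightarrow> smooth_on f I \<Longrightarrow> smooth_on (\<lambda>t. - f t) I"
  by (intro smooth_on_bounded_linear[OF bounded_linear_minus[OF bounded_linear_ident]])

lemma smooth_on_scaleR:
  "open I \<Longrightarrow> smooth_on f I \<Longrightarrow> smooth_on g I \<Longrightarrow> smooth_on (\<lambda>t. f t *\<^sub>R g t) I"
  by (simp add: smooth_on_iff_times_diff_on times_diff_on_bilinear[OF bounded_bilinear_scaleR])

lemma smooth_on_mult:
  fixes f g :: "real \<Rightarrow> real"
  shows "open I \<Longrightarrow> smooth_on f I \<Longrightarrow> smooth_on g I \<Longrightarrow> smooth_on (\<lambda>t. f t * g t) I"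
  by (simp add: smooth_on_iff_times_diff_on times_diff_on_bilinear[OF bounded_bilinear_mult])

lemma smooth_on_compose:
  "open I \<Longrightarrow> open J \<Longrightarrow> h ` J \<subseteq> I \<Longrightarrow> smooth_on f I \<Longrightarrow> smooth_on h J
    \<Longrightarrow> smooth_on (\<lambda>t. f (h t)) J"
  by (simp add: smooth_on_iff_times_diff_on times_diff_on_compose)

lemma smooth_on_inverse:
  fixes f :: "real \<Rightarrow> real"
  shows "open I \<Longrightarrow> smooth_on f I \<Longrightarrow> (\<And>t. t \<in> I \<Longrightarrow> f t \<noteq> 0) \<Longrightarrow> smooth_on (\<lambda>t. inverse (f t)) I"
  by (simp add: smooth_on_iff_times_diff_on times_diff_on_inverse)

lemma smooth_on_exp: "smooth_on exp (UNIV :: real set)"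
proof -
  have "times_diff_on k exp (UNIV :: real set)" for k
  proof (induction k)
    case (Suc k)
    then show ?case
      by (intro times_diff_on_SucI[where f' = exp])
        (auto simp: has_real_derivative_iff_has_vector_derivative[symmetric] intro!: derivative_eq_intros)
  qed simp
  then show ?thesis by (simp add: smooth_on_iff_times_diff_on)
qed

lemma smooth_on_ident: "open I \<Longrightarrow> smooth_on (\<lambda>t. t) I"
  by (rule smooth_onI[where f' = "\<lambda>t. 1"])
    (auto simp: has_real_derivative_iff_has_vector_derivative[symmetric] intro!: derivative_eq_intros)

lemma smooth_on_ln: "smooth_on ln {0::real<..}"
  by (rule smooth_onI[where f' = inverse])
    (auto simp: has_real_derivative_iff_has_vector_derivative[symmetric]
      intro!: derivative_eq_intros smooth_on_inverse smooth_on_ident simp: inverse_eq_divide)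

lemma smooth_on_sqrt:
  assumes "open I" "smooth_on f I" "\<And>t. t \<in> I \<Longrightarrow> f t > 0"
  shows "smooth_on (\<lambda>t. sqrt (f t)) I"
proof -
  have "smooth_on (\<lambda>t. ln (f t)) I"
    using assms by (intro smooth_on_compose[OF _ _ _ smooth_on_ln]) auto
  then have "smooth_on (\<lambda>t. exp (ln (f t) * (1 / 2))) I"
    using assms
    by (intro smooth_on_compose[OF _ _ _ smooth_on_exp] smooth_on_mult) auto
  moreover have "exp (ln (f t) * (1 / 2)) = sqrt (f t)" if "t \<in> I" for t
    using assms(3)[OF that]  by (simp add: powr_half_sqrt[symmetric] powr_def)
  ultimately show ?thesis
    by (rule smooth_on_cong[OF assms(1)])
qed

section \<open>The stationarity equation, free of parametrization\<close>

text \<open>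
  The reflection in the diagonal plays the role of the rotation by a right angle: it sends a vector
  that is not lightlike to a generator of its Lorentz-orthogonal complement.
\<close>

definition perp :: "real \<times> real \<Rightarrow> real \<times> real" where
  "perp v = (snd v, fst v)"

lemma bounded_linear_perp: "bounded_linear perp"
  unfolding perp_def by (intro bounded_linear_intros)

lemma lor_perp_self: "lor (perp v) v = 0"
  by (simp add: lor_def perp_def)

lemma lor_perp_perp: "lor (perp v) (perp v) = - lor v v"
  by (simp add: lor_def perp_def)

lemma normal_eq_scaleR_perp:
  assumes "lor n v = 0" "lor v v \<noteq> 0"
  obtains \<mu> where "n = \<mu> *\<^sub>R perp v"
proof -
  obtain n1 n2 v1 v2 where [simp]: "n = (n1, n2)" "v = (v1, v2)" by fastforce
  define \<mu> where "\<mu> = (n1 * v2 - n2 * v1) / (v2 * v2 - v1 * v1)"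
  have *: "v2 * v2 - v1 * v1 \<noteq> 0" and **: "n1 * v1 = n2 * v2"
    using assms by (auto simp: lor_def)
  have "n1 * (v2 * v2 - v1 * v1) = (n1 * v2 - n2 * v1) * v2"
    "n2 * (v2 * v2 - v1 * v1) = (n1 * v2 - n2 * v1) * v1"
    using ** by algebra+
  then have "n = \<mu> *\<^sub>R perp v"
    using * by (simp add: \<mu>_def perp_def field_simps)
  then show ?thesis using that by blast
qed

lemma
  fixes \<gamma> :: "real \<Rightarrow> 'a::real_normed_vector"
  assumes "open J" "h ` J \<subseteq> I" "smooth_on \<gamma> I" "smooth_on h J" "s \<in> J"
  shows vderiv_reparam: "vderiv (\<gamma> \<circ> h) s = vderiv h s *\<^sub>R vderiv \<gamma> (h s)"
    and vderiv_vderiv_reparam: "vderiv (vderiv (\<gamma> \<circ> h)) s =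
      vderiv (vderiv h) s *\<^sub>R vderiv \<gamma> (h s) + (vderiv h s)\<^sup>2 *\<^sub>R vderiv (vderiv \<gamma>) (h s)"
proof -
  have chain: "((\<lambda>s. f (h s)) has_vector_derivative vderiv h s *\<^sub>R vderiv f (h s)) (at s)"
    if "s \<in> J" "smooth_on f I" for s and f :: "real \<Rightarrow> 'a"
    using vector_diff_chain_at[of h "vderiv h s" s f "vderiv f (h s)"] that assms
    by (auto simp: o_def intro!: smooth_on_has_vderiv)
  have 1: "vderiv (\<gamma> \<circ> h) s = vderiv h s *\<^sub>R vderiv \<gamma> (h s)" if "s \<in> J" for s
    using chain[OF that assms(3)] by (simp add: vderivI o_def)
  then show "vderiv (\<gamma> \<circ> h) s = vderiv h s *\<^sub>R vderiv \<gamma> (h s)"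
    using assms by blast
  have "((\<lambda>s. vderiv h s *\<^sub>R vderiv \<gamma> (h s)) has_vector_derivative
      vderiv h s *\<^sub>R (vderiv h s *\<^sub>R vderiv (vderiv \<gamma>) (h s)) +
      vderiv (vderiv h) s *\<^sub>R vderiv \<gamma> (h s)) (at s)"
    using chain[OF assms(5) smooth_on_vderiv[OF assms(3)]]
      smooth_on_has_vderiv[OF smooth_on_vderiv[OF assms(4)] assms(5)]
    by (intro bounded_bilinear.has_vector_derivative[OF bounded_bilinear_scaleR])
  then show "vderiv (vderiv (\<gamma> \<circ> h)) s =
      vderiv (vderiv h) s *\<^sub>R vderiv \<gamma> (h s) + (vderiv h s)\<^sup>2 *\<^sub>R vderiv (vderiv \<gamma>) (h s)"
    using vderiv_cong[OF assms(1,5) 1] vderivI by (fastforce simp: power2_eq_square add.commute)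
qed

text \<open>
  The stationarity condition with the normal replaced by the unnormalized \<open>perp \<gamma>'\<close> and arc length
  eliminated; the factor \<open>\<langle>\<gamma>', \<gamma>'\<rangle>\<close> makes both sides scale in the same way under a change of
  parameter.
\<close>

definition stationary_at :: "real \<Rightarrow> (real \<Rightarrow> real \<times> real) \<Rightarrow> real \<Rightarrow> bool" where
  "stationary_at \<alpha> \<gamma> t \<longleftrightarrow>
     lor (perp (vderiv \<gamma> t)) (vderiv (vderiv \<gamma>) t) * \<bar>lor (\<gamma> t) (\<gamma> t)\<bar> =
     \<alpha> * lor (perp (vderiv \<gamma> t)) (\<gamma> t) * lor (vderiv \<gamma> t) (vderiv \<gamma> t)"

lemma lor_scaleR_left: "lor (k *\<^sub>R v) w = k * lor v w"
  and lor_scaleR_right: "lor v (k *\<^sub>R w) = k * lor v w"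
  and lor_add_right: "lor v (w + z) = lor v w + lor v z"
  by (simp_all add: lor_def algebra_simps)

text \<open>
  Under a reparametrization by \<open>h\<close>, the tangential part of the second derivative is annihilated by
  the normal and the rest is multiplied by \<open>h'\<^sup>2\<close>, which arc length turns into the inverse of
  \<open>\<langle>\<gamma>', \<gamma>'\<rangle>\<close>. The factor \<open>\<mu>\<close>, and with it the sign of the normal, cancels.
\<close>

lemma curvature_eq_iff_stationary_at:
  assumes "open J" "h ` J \<subseteq> I" "smooth_on \<gamma> I" "smooth_on h J" "s \<in> J"
    and N: "N s = \<mu> *\<^sub>R perp (vderiv \<gamma> (h s))" "\<mu> \<noteq> 0"
    and space: "lor (vderiv \<gamma> (h s)) (vderiv \<gamma> (h s)) > 0"
    and cone: "\<gamma> (h s) \<notin> light_cone"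
    and arc: "\<bar>lor (vderiv (\<gamma> \<circ> h) s) (vderiv (\<gamma> \<circ> h) s)\<bar> = 1"
  shows "curvature N (\<gamma> \<circ> h) s =
      - \<alpha> * (lor (N s) ((\<gamma> \<circ> h) s) / \<bar>lor ((\<gamma> \<circ> h) s) ((\<gamma> \<circ> h) s)\<bar>)
    \<longleftrightarrow> stationary_at \<alpha> \<gamma> (h s)"
proof -
  define S where "S = lor (vderiv \<gamma> (h s)) (vderiv \<gamma> (h s))"
  define K where "K = lor (perp (vderiv \<gamma> (h s))) (vderiv (vderiv \<gamma>) (h s))"
  define P where "P = lor (perp (vderiv \<gamma> (h s))) (\<gamma> (h s))"
  define Q where "Q = \<bar>lor (\<gamma> (h s)) (\<gamma> (h s))\<bar>"
  define k where "k = vderiv h s"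
  have pos: "Q > 0" "S > 0" using cone space by (auto simp: Q_def S_def light_cone_def)
  have "\<bar>k\<^sup>2 * S\<bar> = 1"
    using arc unfolding vderiv_reparam[OF assms(1-5)]
    by (simp add: S_def k_def lor_scaleR_left lor_scaleR_right power2_eq_square mult.assoc)
  then have kS: "k\<^sup>2 * S = 1" using pos by simp
  have "curvature N (\<gamma> \<circ> h) s = - (\<mu> * k\<^sup>2 * K)"
    unfolding curvature_def vderiv_vderiv_reparam[OF assms(1-5)] N(1)
    by (simp add: lor_scaleR_left lor_scaleR_right lor_add_right lor_perp_self K_def k_def)
  moreover have "- \<alpha> * (lor (N s) ((\<gamma> \<circ> h) s) / \<bar>lor ((\<gamma> \<circ> h) s) ((\<gamma> \<circ> h) s)\<bar>) =
      - (\<mu> * (\<alpha> * P / Q))"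
    by (simp add: N lor_scaleR_left P_def Q_def)
  moreover have "- (\<mu> * k\<^sup>2 * K) = - (\<mu> * (\<alpha> * P / Q)) \<longleftrightarrow> S * (k\<^sup>2 * K * Q) = S * (\<alpha> * P)"
    using pos N(2) by (simp add: field_simps)
  moreover have "S * (k\<^sup>2 * K * Q) = (k\<^sup>2 * S) * (K * Q)" by (simp add: algebra_simps)
  moreover have "stationary_at \<alpha> \<gamma> (h s) \<longleftrightarrow> K * Q = S * (\<alpha> * P)"
    by (simp only: stationary_at_def S_def K_def P_def Q_def mult.commute)
  ultimately show ?thesis by (simp only: kS mult_1)
qed

lemma stationary_imp_stationary_at:
  assumes "stationary \<alpha> \<gamma> I" "spacelike \<gamma> I" "t \<in> I"
  shows "stationary_at \<alpha> \<gamma> t"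
proof -
  obtain h J N where J: "open_interval J" and h: "regular_on h J" "h ` J = I"
    and arc: "arc_length_param (\<gamma> \<circ> h) J" and N: "unit_normal N (\<gamma> \<circ> h) J"
    and eq: "\<And>s. s \<in> J \<Longrightarrow> curvature N (\<gamma> \<circ> h) s =
           - \<alpha> * (lor (N s) ((\<gamma> \<circ> h) s) / \<bar>lor ((\<gamma> \<circ> h) s) ((\<gamma> \<circ> h) s)\<bar>)"
    and cone: "\<gamma> ` I \<inter> light_cone = {}"
    using assms(1) unfolding stationary_def by blast
  obtain s where s: "s \<in> J" "t = h s" using h assms(3) by blast
  have hyps: "open J" "h ` J \<subseteq> I" "smooth_on \<gamma> I" "smooth_on h J" "s \<in> J"
    using J h s assms(2) by (auto simp: open_interval_def regular_on_def spacelike_def)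
  have space: "lor (vderiv \<gamma> (h s)) (vderiv \<gamma> (h s)) > 0"
    using assms(2,3) s by (auto simp: spacelike_def)
  have "vderiv h s \<noteq> 0" using h s by (auto simp: regular_on_def)
  moreover have "lor (N s) (vderiv (\<gamma> \<circ> h) s) = 0"
    using N s by (auto simp: unit_normal_def)
  ultimately have "lor (N s) (vderiv \<gamma> (h s)) = 0"
    unfolding vderiv_reparam[OF hyps] by (simp add: lor_scaleR_right)
  then obtain \<mu> where \<mu>: "N s = \<mu> *\<^sub>R perp (vderiv \<gamma> (h s))"
    using normal_eq_scaleR_perp space by (metis less_irrefl)
  have "\<bar>lor (N s) (N s)\<bar> = 1" using N s by (auto simp: unit_normal_def)
  then have "\<mu> \<noteq> 0" unfolding \<mu> by (auto simp: lor_scaleR_left)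
  moreover have "\<gamma> (h s) \<notin> light_cone" using cone s assms(3) by blast
  moreover have "\<bar>lor (vderiv (\<gamma> \<circ> h) s) (vderiv (\<gamma> \<circ> h) s)\<bar> = 1"
    using arc s by (auto simp: arc_length_param_def)
  ultimately show ?thesis
    using curvature_eq_iff_stationary_at[where N = N and \<mu> = \<mu>, OF hyps \<mu> _ space] eq s by blast
qed

lemma smooth_on_fst: "open I \<Longrightarrow> smooth_on f I \<Longrightarrow> smooth_on (\<lambda>t. fst (f t)) I"
  and smooth_on_snd: "open I \<Longrightarrow> smooth_on f I \<Longrightarrow> smooth_on (\<lambda>t. snd (f t)) I"
  by (simp_all add: smooth_on_bounded_linear[OF bounded_linear_fst]
      smooth_on_bounded_linear[OF bounded_linear_snd])

lemma smooth_on_lor: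
  assumes "open I" "smooth_on f I" "smooth_on g I"
  shows "smooth_on (\<lambda>t. lor (f t) (g t)) I"
  unfolding lor_def diff_conv_add_uminus using assms
  by (intro smooth_on_add smooth_on_mult smooth_on_minus smooth_on_fst smooth_on_snd)

text \<open>
  For \<open>v\<close> the speed of a curve this yields the parametrization by arc length: \<open>h\<close> inverts the
  arc-length function. It is smooth because it solves the autonomous equation \<open>h' = 1 / v(h)\<close>, whose
  right-hand side has as many derivatives as \<open>h\<close>.
\<close>

lemma smooth_inverse_of_antiderivative:
  fixes v :: "real \<Rightarrow> real"
  assumes v: "smooth_on v UNIV" "\<And>t. v t > 0"
  obtains h J where "open_interval J" "smooth_on h J" "h ` J = UNIV"
    "\<And>s. s \<in> J \<Longrightarrow> vderiv h s = inverse (v (h s))"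
proof -
  have "continuous_on UNIV v" by (rule smooth_on_continuous_on[OF v(1)])
  then obtain S where S: "\<And>t. (S has_vector_derivative v t) (at t)"
    using einterval_antiderivative[of "-\<infinity>" "\<infinity>" v]
    by (auto simp: continuous_on_eq_continuous_at)
  then have dS: "(S has_real_derivative v t) (at t)" for t
    by (simp add: has_real_derivative_iff_has_vector_derivative)
  have mono: "strict_mono S"
    using DERIV_pos_imp_increasing[of _ _ S] dS v(2) by (metis strict_monoI)
  then have inj: "inj S" by (rule strict_mono_imp_inj_on)
  have cont: "continuous_on UNIV S"
    using dS by (meson DERIV_isCont continuous_at_imp_continuous_on)
  define J where "J = range S"
  define h where "h = inv S"
  have hS: "h (S t) = t" for t by (simp add: h_def inj)
  have "open J" unfolding J_def
    using injective_eq_1d_open_map_UNIV[of UNIV S] cont inj by auto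
  moreover have "connected J"
    unfolding J_def using cont connected_continuous_image connected_UNIV by blast
  ultimately have J: "open_interval J"
    by (auto simp: open_interval_def is_interval_connected_1 J_def)
  have dh: "(h has_vector_derivative inverse (v (h s))) (at s)" if s: "s \<in> J" for s
  proof -
    obtain t where t: "s = S t" using s unfolding J_def by blast
    have "(h has_real_derivative inverse (v t)) (at (S t))"
      using dS[of t] v(2)[of t] cont hS unfolding has_field_derivative_def
      by (intro has_derivative_inverse_strong[where S = UNIV and f = S and x = t and f' = "(*) (v t)"])
        (auto simp: fun_eq_iff less_imp_neq[symmetric])
    then show ?thesis by (simp add: t hS has_real_derivative_iff_has_vector_derivative)
  qed
  have "times_diff_on k h J" for k
  proof (induction k)
    case (Suc k)
    then have "times_diff_on k (\<lambda>s. v (h s)) J"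
      using v(1) \<open>open J\<close> times_diff_on_compose[of UNIV J h k v]
      by (simp add: smooth_on_iff_times_diff_on)
    then have "times_diff_on k (\<lambda>s. inverse (v (h s))) J"
      using v(2) by (intro times_diff_on_inverse[OF \<open>open J\<close>]) (auto simp: less_imp_neq[symmetric])
    then show ?case
      by (intro times_diff_on_SucI[OF \<open>open J\<close> dh])
  qed simp
  then have "smooth_on h J" by (simp add: smooth_on_iff_times_diff_on)
  moreover have "h ` J = UNIV" by (auto simp: J_def image_image hS)
  ultimately show ?thesis using that J dh vderivI by blast
qed

lemma stationary_at_imp_stationary:
  assumes sp: "spacelike \<gamma> UNIV" and cone: "range \<gamma> \<inter> light_cone = {}"
    and eq: "\<And>t. stationary_at \<alpha> \<gamma> t"
  shows "stationary \<alpha> \<gamma> UNIV"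
proof -
  define v where "v t = sqrt (lor (vderiv \<gamma> t) (vderiv \<gamma> t))" for t
  have \<gamma>: "smooth_on \<gamma> UNIV" and pos: "lor (vderiv \<gamma> t) (vderiv \<gamma> t) > 0" for t
    using sp by (auto simp: spacelike_def regular_on_def)
  have "smooth_on v UNIV"
    unfolding v_def using pos smooth_on_vderiv[OF \<gamma>] by (intro smooth_on_sqrt smooth_on_lor) auto
  moreover have vpos: "v t > 0" for t by (simp add: v_def pos)
  ultimately obtain h J where J: "open_interval J" and h: "smooth_on h J" "h ` J = UNIV"
    and dh: "\<And>s. s \<in> J \<Longrightarrow> vderiv h s = inverse (v (h s))"
    by (rule smooth_inverse_of_antiderivative[of v]) iprover
  have "open J" using J by (simp add: open_interval_def)
  note hyps = this _ \<gamma> h(1)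
  define N where "N s = perp (vderiv (\<gamma> \<circ> h) s)" for s
  have arc: "lor (vderiv (\<gamma> \<circ> h) s) (vderiv (\<gamma> \<circ> h) s) = 1" if "s \<in> J" for s
  proof -
    have "v (h s) * v (h s) = lor (vderiv \<gamma> (h s)) (vderiv \<gamma> (h s))"
      using pos[of "h s"] by (simp add: v_def)
    then show ?thesis
      using vderiv_reparam[OF hyps(1) _ hyps(3) hyps(4) that] dh[OF that] vpos[of "h s"] pos[of "h s"]
      by (simp add: lor_scaleR_left lor_scaleR_right field_simps)
  qed
  have N: "N s = inverse (v (h s)) *\<^sub>R perp (vderiv \<gamma> (h s))" if "s \<in> J" for s
    using vderiv_reparam[OF hyps(1) _ hyps(3) hyps(4) that] dh[OF that]
    by (simp add: N_def perp_def)
  have "smooth_on (\<gamma> \<circ> h) J"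
    unfolding o_def using \<open>open J\<close> \<gamma> h by (auto intro!: smooth_on_compose[of UNIV J h \<gamma>])
  then have "smooth_on N J"
    unfolding N_def
    by (intro smooth_on_bounded_linear[OF bounded_linear_perp \<open>open J\<close>] smooth_on_vderiv)
  then have "unit_normal N (\<gamma> \<circ> h) J"
    using arc by (simp add: unit_normal_def N_def lor_perp_self lor_perp_perp)
  moreover have "curvature N (\<gamma> \<circ> h) s =
      - \<alpha> * (lor (N s) ((\<gamma> \<circ> h) s) / \<bar>lor ((\<gamma> \<circ> h) s) ((\<gamma> \<circ> h) s)\<bar>)" if "s \<in> J" for s
  proof -
    have "\<gamma> (h s) \<notin> light_cone" using cone by blast
    then show ?thesis
      using curvature_eq_iff_stationary_at[where N = N and \<mu> = "inverse (v (h s))" and \<alpha> = \<alpha>,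
          OF hyps(1) _ hyps(3) hyps(4) that N[OF that] _ pos]
        eq arc[OF that] vpos[of "h s"] by simp
  qed
  moreover have "regular_on h J"
    using h dh vpos by (auto simp: regular_on_def less_imp_neq[symmetric])
  moreover have "arc_length_param (\<gamma> \<circ> h) J" using arc by (simp add: arc_length_param_def)
  ultimately show ?thesis
    unfolding stationary_def using sp cone J h(2) by blast
qed

section \<open>Null coordinates and the model curves\<close>

text \<open>
  The null coordinates \<open>x + y\<close> and \<open>x - y\<close>, in which the product and the hyperbolic rotations are
  diagonal.
\<close>

definition null_plus :: "real \<times> real \<Rightarrow> real" where
  "null_plus v = fst v + snd v"

definition null_minus :: "real \<times> real \<Rightarrow> real" where
  "null_minus v = fst v - snd v"

lemma bounded_linear_null_plus: "bounded_linear null_plus"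
  and bounded_linear_null_minus: "bounded_linear null_minus"
  unfolding null_plus_def null_minus_def by (intro bounded_linear_intros)+

lemma lor_self_null: "lor v v = null_plus v * null_minus v"
  and lor_perp_null:
    "lor (perp v) w = (null_plus v * null_minus w - null_minus v * null_plus w) / 2"
  by (simp_all add: lor_def perp_def null_plus_def null_minus_def field_simps)

lemma stationary_at_null_iff:
  "stationary_at \<alpha> \<gamma> t \<longleftrightarrow>
     (null_plus (vderiv \<gamma> t) * null_minus (vderiv (vderiv \<gamma>) t) -
      null_minus (vderiv \<gamma> t) * null_plus (vderiv (vderiv \<gamma>) t)) *
       \<bar>null_plus (\<gamma> t) * null_minus (\<gamma> t)\<bar> =
     \<alpha> * (null_plus (vderiv \<gamma> t) * null_minus (\<gamma> t) -
          null_minus (vderiv \<gamma> t) * null_plus (\<gamma> t)) *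
       (null_plus (vderiv \<gamma> t) * null_minus (vderiv \<gamma> t))"
  unfolding stationary_at_def lor_perp_null lor_self_null by auto

definition null_curve :: "(real \<Rightarrow> real) \<Rightarrow> (real \<Rightarrow> real) \<Rightarrow> real \<Rightarrow> real \<times> real" where
  "null_curve p q t = ((p t + q t) / 2, (p t - q t) / 2)"

lemma null_plus_null_curve [simp]: "null_plus (null_curve p q t) = p t"
  and null_minus_null_curve [simp]: "null_minus (null_curve p q t) = q t"
  by (simp_all add: null_plus_def null_minus_def null_curve_def field_simps)

lemma has_vector_derivative_null_curve:
  assumes "(p has_real_derivative p' t) (at t)" "(q has_real_derivative q' t) (at t)"
  shows "(null_curve p q has_vector_derivative null_curve p' q' t) (at t)"
  unfolding null_curve_def
  using assms
  by (intro has_vector_derivative_Pair)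
    (auto simp: has_real_derivative_iff_has_vector_derivative[symmetric] intro!: derivative_eq_intros)

lemma smooth_on_null_curve:
  assumes "open I" "smooth_on p I" "smooth_on q I"
  shows "smooth_on (null_curve p q) I"
proof -
  have "smooth_on (\<lambda>t. p t *\<^sub>R (1/2, 1/2) + q t *\<^sub>R (1/2 :: real, - 1/2 :: real)) I"
    using assms by (intro smooth_on_add smooth_on_scaleR) auto
  then show ?thesis
    by (rule smooth_on_cong[OF assms(1)]) (simp add: null_curve_def field_simps)
qed

text \<open>
  In null coordinates the curve is \<open>p = K exp (w + s + a)\<close>, \<open>q = - K exp (w - s - a)\<close>, so each derivative
  is a multiple of \<open>p\<close> or \<open>q\<close>: \<open>p' = (u + 1) p\<close>, \<open>q' = (u - 1) q\<close>. Dividing the stationarity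
  equation by the common factor \<open>(p q)\<^sup>2\<close> leaves a polynomial identity in \<open>u\<close>, which holds by the Riccati equation. The phase \<open>a\<close> and
  the factor \<open>K\<close> cover the images of the models under hyperbolic rotations, the central
  reflection and dilations.
\<close>

lemma riccati_curve_stationary:
  fixes w u :: "real \<Rightarrow> real" and K a \<alpha> :: real
  assumes w: "\<And>s. (w has_real_derivative u s) (at s)"
    and u: "\<And>s. (u has_real_derivative (\<alpha> - 1) * (1 - (u s)\<^sup>2)) (at s)"
    and less: "\<And>s. (u s)\<^sup>2 < 1" and K: "K \<noteq> 0"
  defines "\<gamma> \<equiv> \<lambda>s. (K * exp (w s)) *\<^sub>R (sinh (s + a), cosh (s + a))"
  shows "spacelike \<gamma> UNIV" "range \<gamma> \<subseteq> cone_minus" "stationary \<alpha> \<gamma> UNIV"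
    "vderiv \<gamma> s = (K * exp (w s)) *\<^sub>R
       (u s * sinh (s + a) + cosh (s + a), u s * cosh (s + a) + sinh (s + a))"
proof -
  define p where "p s = K * exp (w s + (s + a))" for s
  define q where "q s = - K * exp (w s + - (s + a))" for s
  define p' where "p' s = (u s + 1) * p s" for s
  define q' where "q' s = (u s - 1) * q s" for s
  define p'' where "p'' s = ((\<alpha> - 1) * (1 - (u s)\<^sup>2) + (u s + 1)\<^sup>2) * p s" for s
  define q'' where "q'' s = ((\<alpha> - 1) * (1 - (u s)\<^sup>2) + (u s - 1)\<^sup>2) * q s" for s
  have \<gamma>: "\<gamma> = null_curve p q"
    by (auto simp: fun_eq_iff \<gamma>_def null_curve_def p_def q_def sinh_def cosh_def exp_add exp_diff
        exp_minus field_simps)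
  have dp: "(p has_real_derivative p' s) (at s)" and dq: "(q has_real_derivative q' s) (at s)" for s
    unfolding p_def q_def p'_def q'_def using w[of s]
    by (auto intro!: derivative_eq_intros simp: algebra_simps)
  have dp': "(p' has_real_derivative p'' s) (at s)" and dq': "(q' has_real_derivative q'' s) (at s)" for s
    unfolding p'_def[abs_def] q'_def[abs_def] p''_def q''_def using u[of s] dp[of s] dq[of s]
    by (auto intro!: derivative_eq_intros simp: p'_def q'_def algebra_simps power2_eq_square)
  have d1: "vderiv \<gamma> = null_curve p' q'"
    unfolding \<gamma> by (intro ext vderivI has_vector_derivative_null_curve dp dq)
  have d2: "vderiv (null_curve p' q') = null_curve p'' q''"
    by (intro ext vderivI has_vector_derivative_null_curve dp' dq')
  \<comment> \<open>A solution gains one derivative from each use of its equation.\<close>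
  have "times_diff_on k u UNIV" for k
  proof (induction k)
    case (Suc k)
    have "times_diff_on k (\<lambda>s. (\<alpha> - 1) * (1 + - (u s * u s))) UNIV"
      by (intro times_diff_on_bilinear[OF bounded_bilinear_mult] times_diff_on_const
          times_diff_on_add times_diff_on_bounded_linear[OF bounded_linear_minus[OF bounded_linear_ident]]
          Suc) auto
    then show ?case
      using u by (intro times_diff_on_SucI[where f' = "\<lambda>s. (\<alpha> - 1) * (1 + - (u s * u s))"])
        (auto simp: has_real_derivative_iff_has_vector_derivative power2_eq_square)
  qed simp
  then have "smooth_on u UNIV" by (simp add: smooth_on_iff_times_diff_on)
  then have ws: "smooth_on w UNIV"
    using w by (intro smooth_onI[of _ w u]) (auto simp: has_real_derivative_iff_has_vector_derivative)
  have "smooth_on (\<lambda>s. K * exp (w s + (s + a))) UNIV" "smooth_on (\<lambda>s. - K * exp (w s + - (s + a))) UNIV"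
    by (intro smooth_on_mult smooth_on_compose[OF _ _ _ smooth_on_exp] smooth_on_add ws
        smooth_on_ident smooth_on_minus smooth_on_const; simp)+
  then have sm: "smooth_on \<gamma> UNIV"
    unfolding \<gamma> p_def[abs_def] q_def[abs_def] by (intro smooth_on_null_curve open_UNIV)
  have pq: "p s * q s < 0" for s
  proof -
    have "p s * q s = - (K\<^sup>2 * (exp (w s + (s + a)) * exp (w s + - (s + a))))"
      by (simp add: p_def q_def power2_eq_square)
    then show ?thesis using K by (simp add: zero_less_mult_iff)
  qed
  have lor': "lor (vderiv \<gamma> s) (vderiv \<gamma> s) = (1 - (u s)\<^sup>2) * - (p s * q s)" for s
    unfolding d1 lor_self_null by (simp add: p'_def q'_def algebra_simps power2_eq_square)
  have pos: "lor (vderiv \<gamma> s) (vderiv \<gamma> s) > 0" for s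
    unfolding lor' using less[of s] pq[of s] by (intro mult_pos_pos) auto
  show sp: "spacelike \<gamma> UNIV"
    unfolding spacelike_def regular_on_def
  proof (intro conjI ballI sm pos)
    show "vderiv \<gamma> t \<noteq> 0" for t
      using pos[of t] by (auto simp: lor_def)
  qed
  show cm: "range \<gamma> \<subseteq> cone_minus"
    unfolding cone_minus_def using pq by (auto simp: lor_self_null \<gamma>)
  have "stationary_at \<alpha> \<gamma> s" for s
  proof -
    have "\<bar>p s * q s\<bar> = - (p s * q s)" using pq[of s] by simp
    then show ?thesis
      unfolding stationary_at_null_iff d1 d2 unfolding \<gamma> null_plus_null_curve null_minus_null_curve
        p'_def q'_def p''_def q''_def
      by (simp only:) (simp add: algebra_simps power2_eq_square)
  qed
  moreover have "range \<gamma> \<inter> light_cone = {}"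
    using cm by (auto simp: cone_minus_def light_cone_def)
  ultimately show "stationary \<alpha> \<gamma> UNIV"
    using stationary_at_imp_stationary sp by blast
  show "vderiv \<gamma> s = (K * exp (w s)) *\<^sub>R
       (u s * sinh (s + a) + cosh (s + a), u s * cosh (s + a) + sinh (s + a))"
    unfolding d1 by (auto simp: fun_eq_iff null_curve_def p_def q_def p'_def q'_def sinh_def cosh_def
        exp_add exp_diff exp_minus field_simps)
qed

text \<open>
  Working with the logarithm of the profile and its derivative treats \<open>\<alpha> = 1\<close> and \<open>\<alpha> \<noteq> 1\<close> alike: the
  slope solves the same Riccati equation in both cases.
\<close>

definition log_profile :: "real \<Rightarrow> real \<Rightarrow> real \<Rightarrow> real" where
  "log_profile \<alpha> c s = (if \<alpha> = 1 then c * s else ln (cosh ((\<alpha> - 1) * s)) / (\<alpha> - 1))"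

definition slope :: "real \<Rightarrow> real \<Rightarrow> real \<Rightarrow> real" where
  "slope \<alpha> c s = (if \<alpha> = 1 then c else tanh ((\<alpha> - 1) * s))"

lemma profile_eq_exp: "profile \<alpha> c s = exp (log_profile \<alpha> c s)"
  by (simp add: profile_def log_profile_def powr_def)

lemma has_real_derivative_log_profile:
  "(log_profile \<alpha> c has_real_derivative slope \<alpha> c s) (at s)"
  unfolding log_profile_def[abs_def] slope_def
  by (auto intro!: derivative_eq_intros simp: tanh_def cosh_real_pos)

lemma has_real_derivative_slope:
  "(slope \<alpha> c has_real_derivative (\<alpha> - 1) * (1 - (slope \<alpha> c s)\<^sup>2)) (at s)"
  unfolding slope_def[abs_def] by (auto intro!: derivative_eq_intros)

lemma slope_square_less_one: "c\<^sup>2 < 1 \<Longrightarrow> (slope \<alpha> c s)\<^sup>2 < 1"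
  using tanh_real_bounds[of "(\<alpha> - 1) * s"] by (auto simp: slope_def abs_square_less_1 abs_less_iff)

lemma stationary_scaled_model_curve:
  fixes \<alpha> c K a :: real
  assumes "c\<^sup>2 < 1" "K \<noteq> 0"
  shows "stationary \<alpha> (\<lambda>s. (K * profile \<alpha> c s) *\<^sub>R (sinh (s + a), cosh (s + a))) UNIV"
  using riccati_curve_stationary(3)[OF has_real_derivative_log_profile has_real_derivative_slope
      slope_square_less_one[OF assms(1)] assms(2)]
  by (simp add: profile_eq_exp)

lemma model_curve_eq:
  "model_curve \<alpha> c = (\<lambda>s. (1 * exp (log_profile \<alpha> c s)) *\<^sub>R (sinh (s + 0), cosh (s + 0)))"
  by (auto simp: model_curve_def profile_eq_exp)

lemma spacelike_stationary_model_curve: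
  assumes "c\<^sup>2 < 1"
  shows "spacelike (model_curve \<alpha> c) UNIV" "range (model_curve \<alpha> c) \<subseteq> cone_minus"
    "stationary \<alpha> (model_curve \<alpha> c) UNIV"
    and vderiv_model_curve: "vderiv (model_curve \<alpha> c) s =
      profile \<alpha> c s *\<^sub>R (slope \<alpha> c s * sinh s + cosh s, slope \<alpha> c s * cosh s + sinh s)"
  using riccati_curve_stationary[OF has_real_derivative_log_profile has_real_derivative_slope
      slope_square_less_one[OF assms(1)], of 1 _ 0]
  unfolding model_curve_eq by (simp_all add: profile_eq_exp)

section \<open>Classification of the spacelike stationary curves\<close>

lemma has_real_derivative_ln_abs:
  fixes f :: "real \<Rightarrow> real"
  assumes "(f has_real_derivative f') (at t)" "f t \<noteq> 0"
  shows "((\<lambda>t. ln \<bar>f t\<bar>) has_real_derivative f' / f t) (at t)"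
proof -
  have "((\<lambda>t. ln ((f t)\<^sup>2) / 2) has_real_derivative f' / f t) (at t)"
    using assms by (auto intro!: derivative_eq_intros simp: field_simps power2_eq_square
        zero_less_mult_iff linorder_neq_iff)
  moreover have ln_abs: "ln \<bar>x\<bar> = ln (x\<^sup>2) / 2" for x :: real
  proof (cases "x = 0")
    case False
    have "ln (x\<^sup>2) = ln (\<bar>x\<bar>\<^sup>2)" by simp
    also have "\<dots> = 2 * ln \<bar>x\<bar>" using False by (subst ln_realpow) auto
    finally show ?thesis by simp
  qed simp
  ultimately show ?thesis by (simp only:)
qed

lemma sgn_eq_on_connected:
  fixes f :: "real \<Rightarrow> real"
  assumes "connected I" "continuous_on I f" "\<And>t. t \<in> I \<Longrightarrow> f t \<noteq> 0" "s \<in> I" "t \<in> I"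
  shows "sgn (f s) = sgn (f t)"
proof (rule ccontr)
  assume "sgn (f s) \<noteq> sgn (f t)"
  then have "f s \<le> 0 \<and> 0 \<le> f t \<or> f t \<le> 0 \<and> 0 \<le> f s"
    by (auto simp: sgn_if split: if_splits)
  moreover have "connected (f ` I)"
    using assms by (intro connected_continuous_image)
  ultimately have "0 \<in> f ` I"
    using assms(4,5) connectedD_interval[of "f ` I"] by blast
  then show False using assms(3) by auto
qed

definition boost :: "real \<Rightarrow> real \<times> real \<Rightarrow> real \<times> real" where
  "boost \<tau> v = (cosh \<tau> * fst v + sinh \<tau> * snd v, sinh \<tau> * fst v + cosh \<tau> * snd v)"

lemma linear_isometry_boost:
  assumes "\<sigma>\<^sup>2 = 1"
  shows "linear_isometry (\<lambda>v. \<sigma> *\<^sub>R boost \<tau> v)"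
proof -
  have "lor (\<sigma> *\<^sub>R boost \<tau> v) (\<sigma> *\<^sub>R boost \<tau> w) =
      \<sigma>\<^sup>2 * ((cosh \<tau>)\<^sup>2 - (sinh \<tau>)\<^sup>2) * lor v w" for v w
    by (simp add: lor_def boost_def algebra_simps power2_eq_square)
  then have "lor (\<sigma> *\<^sub>R boost \<tau> v) (\<sigma> *\<^sub>R boost \<tau> w) = lor v w" for v w
    by (simp add: assms cosh_square_eq)
  moreover have "linear (\<lambda>v. \<sigma> *\<^sub>R boost \<tau> v)"
    by (rule linearI) (simp_all add: boost_def algebra_simps)
  ultimately show ?thesis by (simp add: linear_isometry_def)
qed

lemma boost_unit_hyperbola: "boost \<tau> (sinh s, cosh s) = (sinh (s + \<tau>), cosh (s + \<tau>))"
  by (simp add: boost_def sinh_add cosh_add algebra_simps)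

text \<open>
  With \<open>\<phi> = (ln \<bar>p\<bar> - ln \<bar>q\<bar>) / 2\<close> the stationarity equation, divided by \<open>p q p' q'\<close>, states that
  \<open>p''/p' - q''/q' = \<alpha> (p'/p - q'/q)\<close>. Both sides are logarithmic derivatives, so
  \<open>ln \<bar>p'/q'\<bar> - ln \<bar>p/q\<bar> - 2 (\<alpha> - 1) \<phi>\<close> is a constant \<open>2 \<kappa>\<close>. Since \<open>p'/p\<close> and \<open>- q'/q\<close> have the same
  sign, this determines their quotient \<open>exp (2 \<theta>)\<close>, \<open>\<theta> = (\<alpha> - 1) \<phi> + \<kappa>\<close>, and \<open>w'/\<phi>'\<close>, the
  quotient of their difference and their sum, is \<open>tanh \<theta>\<close>.
\<close>

lemma spacelike_stationary_polar:
  assumes I: "open_interval I" and stat: "stationary \<alpha> \<delta> I" and sp: "spacelike \<delta> I"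
    and cone: "\<delta> ` I \<subseteq> cone_minus"
  shows "\<exists>\<phi> w \<sigma> \<kappa>. regular_on \<phi> I \<and> (\<sigma> = 1 \<or> \<sigma> = - 1) \<and>
    (\<forall>t\<in>I. \<delta> t = (\<sigma> * exp (w t)) *\<^sub>R (sinh (\<phi> t), cosh (\<phi> t))) \<and>
    (\<forall>t\<in>I. (w has_real_derivative tanh ((\<alpha> - 1) * \<phi> t + \<kappa>) * vderiv \<phi> t) (at t))"
proof -
  have "open I" and conv: "convex I" and conn: "connected I" and "I \<noteq> {}"
    using I by (simp_all add: open_interval_def is_interval_convex_1 convex_connected)
  have \<delta>: "smooth_on \<delta> I" using sp by (simp add: spacelike_def regular_on_def)
  define p p1 p2 where "p t = null_plus (\<delta> t)" and "p1 t = null_plus (vderiv \<delta> t)"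
    and "p2 t = null_plus (vderiv (vderiv \<delta>) t)" for t
  define q q1 q2 where "q t = null_minus (\<delta> t)" and "q1 t = null_minus (vderiv \<delta> t)"
    and "q2 t = null_minus (vderiv (vderiv \<delta>) t)" for t
  have dp: "(p has_real_derivative p1 t) (at t)" and dq: "(q has_real_derivative q1 t) (at t)"
    and dp1: "(p1 has_real_derivative p2 t) (at t)" and dq1: "(q1 has_real_derivative q2 t) (at t)"
    if "t \<in> I" for t
    using bounded_linear.has_vector_derivative[OF bounded_linear_null_plus]
      bounded_linear.has_vector_derivative[OF bounded_linear_null_minus]
      smooth_on_has_vderiv[OF \<delta> that] smooth_on_has_vderiv[OF smooth_on_vderiv[OF \<delta>] that]
    unfolding has_real_derivative_iff_has_vector_derivative p_def[abs_def] p1_def[abs_def] p2_def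
      q_def[abs_def] q1_def[abs_def] q2_def
    by blast+
  have smooths: "smooth_on p I" "smooth_on q I" "smooth_on p1 I" "smooth_on q1 I"
    using smooth_on_bounded_linear[OF bounded_linear_null_plus \<open>open I\<close>]
      smooth_on_bounded_linear[OF bounded_linear_null_minus \<open>open I\<close>] \<delta> smooth_on_vderiv[OF \<delta>]
    unfolding p_def[abs_def] p1_def[abs_def] q_def[abs_def] q1_def[abs_def]
    by blast+
  have pq: "p t * q t < 0" if "t \<in> I" for t
    using cone that by (auto simp: cone_minus_def p_def q_def lor_self_null)
  have pq1: "p1 t * q1 t > 0" if "t \<in> I" for t
    using sp that by (auto simp: spacelike_def p1_def q1_def lor_self_null)
  have nz: "p t \<noteq> 0" "q t \<noteq> 0" "p1 t \<noteq> 0" "q1 t \<noteq> 0" if "t \<in> I" for t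
    using pq[OF that] pq1[OF that] by auto
  have ode: "p2 t / p1 t - q2 t / q1 t = \<alpha> * (p1 t / p t - q1 t / q t)" if t: "t \<in> I" for t
  proof -
    have "(p1 t * q2 t - q1 t * p2 t) * \<bar>p t * q t\<bar> =
        \<alpha> * (p1 t * q t - q1 t * p t) * (p1 t * q1 t)"
      using stationary_imp_stationary_at[OF stat sp t]
      unfolding stationary_at_null_iff p_def p1_def p2_def q_def q1_def q2_def .
    moreover have "\<bar>p t * q t\<bar> = - (p t * q t)" using pq[OF t] by simp
    ultimately show ?thesis using nz[OF t] by (simp add: field_simps)
  qed
  define \<phi> where "\<phi> t = (ln \<bar>p t\<bar> - ln \<bar>q t\<bar>) / 2" for t
  define w where "w t = (ln \<bar>p t\<bar> + ln \<bar>q t\<bar>) / 2" for t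
  define \<phi>' where "\<phi>' t = (p1 t / p t - q1 t / q t) / 2" for t
  note ln_abs = has_real_derivative_ln_abs[OF dp nz(1)] has_real_derivative_ln_abs[OF dq nz(2)]
    has_real_derivative_ln_abs[OF dp1 nz(3)] has_real_derivative_ln_abs[OF dq1 nz(4)]
  have d\<phi>: "(\<phi> has_real_derivative \<phi>' t) (at t)"
    and dw: "(w has_real_derivative (p1 t / p t + q1 t / q t) / 2) (at t)" if "t \<in> I" for t
    unfolding \<phi>_def[abs_def] w_def[abs_def] \<phi>'_def
    by (rule DERIV_cdivide[OF DERIV_diff[OF ln_abs(1,2)[OF that that]]]
        DERIV_cdivide[OF DERIV_add[OF ln_abs(1,2)[OF that that]]])+
  define g where "g t = (ln \<bar>p1 t\<bar> - ln \<bar>q1 t\<bar>) - 2 * \<phi> t - 2 * (\<alpha> - 1) * \<phi> t" for t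
  have "(g has_real_derivative 0) (at t)" if "t \<in> I" for t
  proof -
    have zero: "p2 t / p1 t - q2 t / q1 t - 2 * \<phi>' t - 2 * (\<alpha> - 1) * \<phi>' t = 0"
      unfolding ode[OF that] \<phi>'_def by (simp add: algebra_simps add_divide_distrib diff_divide_distrib)
    show ?thesis
      unfolding g_def[abs_def]
      using DERIV_diff[OF DERIV_diff[OF DERIV_diff[OF ln_abs(3,4)[OF that that]]
            DERIV_cmult[OF d\<phi>[OF that], of 2]] DERIV_cmult[OF d\<phi>[OF that], of "2 * (\<alpha> - 1)"]]
      unfolding zero .
  qed
  then obtain G where G: "\<And>t. t \<in> I \<Longrightarrow> g t = G"
    using has_field_derivative_zero_constant[OF conv, of g] has_field_derivative_at_within
    by blast
  define \<kappa> where "\<kappa> = G / 2"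
  have \<kappa>: "g t = 2 * \<kappa>" if "t \<in> I" for t using G[OF that] by (simp add: \<kappa>_def)
  define \<theta> where "\<theta> t = (\<alpha> - 1) * \<phi> t + \<kappa>" for t
  have ratio: "p1 t / p t = exp (2 * \<theta> t) * - (q1 t / q t)" if t: "t \<in> I" for t
  proof -
    have "ln \<bar>p1 t\<bar> - ln \<bar>q1 t\<bar> - (ln \<bar>p t\<bar> - ln \<bar>q t\<bar>) = 2 * \<theta> t"
      using \<kappa>[OF t] by (simp add: g_def \<theta>_def \<phi>_def field_simps)
    then have "ln \<bar>p1 t\<bar> - ln \<bar>p t\<bar> = 2 * \<theta> t + (ln \<bar>q1 t\<bar> - ln \<bar>q t\<bar>)" by simp
    then have "exp (ln \<bar>p1 t\<bar> - ln \<bar>p t\<bar>) = exp (2 * \<theta> t) * exp (ln \<bar>q1 t\<bar> - ln \<bar>q t\<bar>)"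
      by (simp only: exp_add)
    then have "\<bar>p1 t\<bar> / \<bar>p t\<bar> = exp (2 * \<theta> t) * (\<bar>q1 t\<bar> / \<bar>q t\<bar>)"
      using nz[OF t] by (simp add: exp_diff)
    moreover have "(p1 t > 0 \<and> q1 t > 0 \<or> p1 t < 0 \<and> q1 t < 0) \<and> (p t > 0 \<and> q t < 0 \<or> p t < 0 \<and> q t > 0)"
      using pq[OF t] pq1[OF t] by (auto simp: mult_less_0_iff zero_less_mult_iff)
    ultimately show ?thesis by auto
  qed
  have \<phi>'_nz: "\<phi>' t \<noteq> 0" if t: "t \<in> I" for t
  proof -
    have "\<phi>' t = - (q1 t / q t) * (exp (2 * \<theta> t) + 1) / 2"
    proof -
      have "(X * - B - B) / 2 = - B * (X + 1) / 2" for X B :: real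
        by (simp add: field_simps)
      then show ?thesis unfolding \<phi>'_def ratio[OF t] .
    qed
    moreover have "exp (2 * \<theta> t) + 1 > 0" by (simp add: add_pos_pos)
    ultimately show ?thesis using nz[OF t] by simp
  qed
  have v\<phi>: "vderiv \<phi> t = \<phi>' t" if "t \<in> I" for t
    using d\<phi>[OF that] by (intro vderivI) (simp add: has_real_derivative_iff_has_vector_derivative)
  have w': "(p1 t / p t + q1 t / q t) / 2 = tanh (\<theta> t) * \<phi>' t" if t: "t \<in> I" for t
  proof -
    define X where "X = exp (2 * \<theta> t)"
    have "X + 1 > 0" by (simp add: X_def add_pos_pos)
    have "X = exp (\<theta> t) * exp (\<theta> t)" by (simp add: X_def flip: exp_add)
    then have "sinh (\<theta> t) = (X - 1) / (2 * exp (\<theta> t))" "cosh (\<theta> t) = (X + 1) / (2 * exp (\<theta> t))"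
      by (simp_all add: sinh_def cosh_def exp_minus field_simps)
    then have tanh: "tanh (\<theta> t) = (X - 1) / (X + 1)"
      by (simp add: tanh_def)
    have "(X * - B + B) / 2 = (X - 1) / (X + 1) * ((X * - B - B) / 2)" for B
      using \<open>X + 1 > 0\<close> by (simp add: field_simps)
    then show ?thesis
      unfolding \<phi>'_def ratio[OF t] tanh X_def[symmetric] .
  qed
  have "smooth_on (\<lambda>t. (p1 t * inverse (p t) + - (q1 t * inverse (q t))) * (1 / 2)) I"
    by (intro smooth_on_mult[OF \<open>open I\<close>] smooth_on_add[OF \<open>open I\<close>] smooth_on_minus[OF \<open>open I\<close>]
        smooth_on_inverse[OF \<open>open I\<close>] smooths smooth_on_const nz)
  then have "smooth_on \<phi>' I"
    by (rule smooth_on_cong[OF \<open>open I\<close>]) (simp add: \<phi>'_def field_simps)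
  then have "smooth_on \<phi> I"
    using smooth_onI[OF \<open>open I\<close> d\<phi>[unfolded has_real_derivative_iff_has_vector_derivative]]
    by blast
  then have reg: "regular_on \<phi> I"
    using v\<phi> \<phi>'_nz by (simp add: regular_on_def)
  obtain t0 where "t0 \<in> I" using \<open>I \<noteq> {}\<close> by blast
  define \<sigma> where "\<sigma> = sgn (p t0)"
  have polar: "\<delta> t = (\<sigma> * exp (w t)) *\<^sub>R (sinh (\<phi> t), cosh (\<phi> t))" if t: "t \<in> I" for t
  proof -
    have "\<sigma> = sgn (p t)"
      unfolding \<sigma>_def
      by (rule sgn_eq_on_connected[OF conn smooth_on_continuous_on[OF smooths(1)] nz(1) \<open>t0 \<in> I\<close> t])
    moreover have "w t + \<phi> t = ln \<bar>p t\<bar>" "w t - \<phi> t = ln \<bar>q t\<bar>"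
      by (simp_all add: w_def \<phi>_def field_simps)
    then have "exp (w t + \<phi> t) = \<bar>p t\<bar>" "exp (w t - \<phi> t) = \<bar>q t\<bar>"
      using nz[OF t] by simp_all
    moreover have "sgn (q t) = - sgn (p t)"
      using pq[OF t] by (auto simp: mult_less_0_iff)
    moreover have "p t = sgn (p t) * \<bar>p t\<bar>" "q t = sgn (q t) * \<bar>q t\<bar>"
      by (simp_all only: sgn_mult_abs)
    ultimately have P: "p t = \<sigma> * exp (w t + \<phi> t)" and Q: "q t = - \<sigma> * exp (w t - \<phi> t)"
      by simp_all
    have "\<delta> t = ((p t + q t) / 2, (p t - q t) / 2)"
      by (simp add: p_def q_def null_plus_def null_minus_def prod_eq_iff)
    then show ?thesis
      unfolding P Q by (simp add: sinh_def cosh_def exp_add exp_diff exp_minus field_simps)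
  qed
  have sign: "\<sigma> = 1 \<or> \<sigma> = - 1"
    using nz(1)[OF \<open>t0 \<in> I\<close>] by (auto simp: \<sigma>_def sgn_if)
  have slope: "(w has_real_derivative tanh ((\<alpha> - 1) * \<phi> t + \<kappa>) * vderiv \<phi> t) (at t)"
    if "t \<in> I" for t
    using dw[OF that] w'[OF that] v\<phi>[OF that] by (simp add: \<theta>_def)
  show ?thesis
    by (intro exI[of _ \<phi>] exI[of _ w] exI[of _ \<sigma>] exI[of _ \<kappa>] conjI ballI reg sign polar slope)
qed

text \<open>
  The shift \<open>\<tau>\<close> absorbs \<open>\<kappa>\<close> into the angle when \<open>\<alpha> \<noteq> 1\<close> and is undone by a boost; for \<open>\<alpha> = 1\<close> the
  constant survives as \<open>c\<close>. If \<open>\<delta>\<close> is maximal, it cannot be a proper arc of the complete curve it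
  lies on, which is itself stationary.
\<close>

lemma spacelike_stationary_is_scaled_model:
  assumes I: "open_interval I" and stat: "stationary \<alpha> \<delta> I" and sp: "spacelike \<delta> I"
    and cone: "\<delta> ` I \<subseteq> cone_minus"
  shows "\<exists>c A r \<phi>. c\<^sup>2 < 1 \<and> linear_isometry A \<and> r > 0 \<and> regular_on \<phi> I \<and>
           (\<forall>t\<in>I. \<delta> t = r *\<^sub>R A (model_curve \<alpha> c (\<phi> t))) \<and>
           (maximal_stationary \<alpha> \<delta> I \<longrightarrow> \<phi> ` I = UNIV)"
proof -
  have "open I" and conv: "convex I"
    using I by (auto simp: open_interval_def is_interval_convex_1)
  obtain \<phi> w \<sigma> \<kappa> where polar: "regular_on \<phi> I \<and> (\<sigma> = 1 \<or> \<sigma> = - 1) \<and>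
    (\<forall>t\<in>I. \<delta> t = (\<sigma> * exp (w t)) *\<^sub>R (sinh (\<phi> t), cosh (\<phi> t))) \<and>
    (\<forall>t\<in>I. (w has_real_derivative tanh ((\<alpha> - 1) * \<phi> t + \<kappa>) * vderiv \<phi> t) (at t))"
    using spacelike_stationary_polar[OF assms] by (elim exE) (rule that)
  have reg: "regular_on \<phi> I" and \<sigma>: "\<sigma> = 1 \<or> \<sigma> = - 1"
    using polar by simp_all
  have \<delta>: "\<delta> t = (\<sigma> * exp (w t)) *\<^sub>R (sinh (\<phi> t), cosh (\<phi> t))"
    and dw: "(w has_real_derivative tanh ((\<alpha> - 1) * \<phi> t + \<kappa>) * vderiv \<phi> t) (at t)"
    if "t \<in> I" for t
    using polar that by simp_all
  define \<tau> where "\<tau> = (if \<alpha> = 1 then 0 else \<kappa> / (\<alpha> - 1))"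
  define c where "c = tanh \<kappa>"
  define \<psi> where "\<psi> t = \<phi> t + \<tau>" for t
  have c: "c\<^sup>2 < 1"
    using tanh_real_bounds[of \<kappa>] by (auto simp: c_def abs_square_less_1 abs_less_iff)
  have slope: "slope \<alpha> c (\<psi> t) = tanh ((\<alpha> - 1) * \<phi> t + \<kappa>)" for t
    by (auto simp: slope_def c_def \<psi>_def \<tau>_def distrib_left)
  have d\<psi>: "(\<psi> has_vector_derivative vderiv \<phi> t) (at t)" if "t \<in> I" for t
    using smooth_on_has_vderiv[of \<phi> I t] reg that
    by (simp add: \<psi>_def[abs_def] regular_on_def has_vector_derivative_add_const)
  have v\<psi>: "vderiv \<psi> t = vderiv \<phi> t" if "t \<in> I" for t using d\<psi>[OF that] by (rule vderivI)
  have "smooth_on \<psi> I"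
    using reg by (intro smooth_onI[OF \<open>open I\<close> d\<psi>]) (simp_all add: regular_on_def smooth_on_vderiv)
  then have reg': "regular_on \<psi> I"
    using reg v\<psi> by (simp add: regular_on_def)
  have "((\<lambda>t. w t - log_profile \<alpha> c (\<psi> t)) has_real_derivative 0) (at t)" if "t \<in> I" for t
  proof -
    have "(\<psi> has_real_derivative vderiv \<phi> t) (at t)"
      using d\<psi>[OF that] by (simp add: has_real_derivative_iff_has_vector_derivative)
    then have "((\<lambda>t. log_profile \<alpha> c (\<psi> t)) has_real_derivative slope \<alpha> c (\<psi> t) * vderiv \<phi> t) (at t)"
      by (rule DERIV_chain2[OF has_real_derivative_log_profile])
    from DERIV_diff[OF dw[OF that] this] show ?thesis by (simp add: slope)
  qed
  then obtain E where E: "\<And>t. t \<in> I \<Longrightarrow> w t - log_profile \<alpha> c (\<psi> t) = E"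
    using has_field_derivative_zero_constant[OF conv, of "\<lambda>t. w t - log_profile \<alpha> c (\<psi> t)"]
      has_field_derivative_at_within by blast
  define A where "A v = \<sigma> *\<^sub>R boost (- \<tau>) v" for v
  have A: "linear_isometry A"
    unfolding A_def[abs_def] using \<sigma> by (intro linear_isometry_boost) auto
  have model: "exp E *\<^sub>R A (model_curve \<alpha> c s) =
      ((\<sigma> * exp E) * profile \<alpha> c s) *\<^sub>R (sinh (s + - \<tau>), cosh (s + - \<tau>))" for s
  proof -
    have "boost (- \<tau>) (model_curve \<alpha> c s) = profile \<alpha> c s *\<^sub>R boost (- \<tau>) (sinh s, cosh s)"
      by (simp add: model_curve_def boost_def algebra_simps)
    then show ?thesis by (simp add: A_def boost_unit_hyperbola mult_ac)
  qed
  have \<delta>_eq: "\<delta> t = exp E *\<^sub>R A (model_curve \<alpha> c (\<psi> t))" if "t \<in> I" for t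
  proof -
    have "w t = E + log_profile \<alpha> c (\<psi> t)" using E[OF that] by simp
    then show ?thesis
      unfolding model \<delta>[OF that] by (simp add: \<psi>_def exp_add profile_eq_exp)
  qed
  have "\<psi> ` I = UNIV" if "maximal_stationary \<alpha> \<delta> I"
  proof -
    have "stationary \<alpha> (\<lambda>s. exp E *\<^sub>R A (model_curve \<alpha> c s)) UNIV"
      unfolding model using \<sigma> by (intro stationary_scaled_model_curve c) auto
    moreover have "open_interval (UNIV :: real set)" by (simp add: open_interval_def)
    ultimately show ?thesis
      using that reg' \<delta>_eq unfolding maximal_stationary_def
      by (elim conjE allE[of _ "\<lambda>s. exp E *\<^sub>R A (model_curve \<alpha> c s)"] allE[of _ UNIV] allE[of _ \<psi>]) blast
  qed
  then show ?thesis
    using c A reg' \<delta>_eq by (intro exI[of _ c] exI[of _ A] exI[of _ "exp E"] exI[of _ \<psi>]) simp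
qed

section \<open>Maximality of the models\<close>

text \<open>
  The range is open since \<open>\<phi>\<close> is injective and continuous, and it is closed in \<open>J\<close> as the set where the
  continuous functions \<open>\<phi> \<circ> g\<close> and the identity agree.
\<close>

lemma range_eq_of_continuous_left_inverse:
  fixes \<phi> g :: "real \<Rightarrow> real"
  assumes J: "open_interval J" and \<phi>: "continuous_on UNIV \<phi>" "range \<phi> \<subseteq> J"
    and g: "continuous_on J g" "\<And>t. g (\<phi> t) = t"
  shows "range \<phi> = J"
proof -
  have "inj \<phi>" using g(2) by (metis injI)
  then have "open (range \<phi>)"
    using injective_eq_1d_open_map_UNIV[of UNIV \<phi>] \<phi>(1) by auto
  then have "openin (top_of_set J) (range \<phi>)"
    using \<phi>(2) by (simp add: openin_open_eq open_subset)
  moreover have "closedin (top_of_set J) (range \<phi>)"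
  proof -
    have "continuous_on J (\<lambda>x. \<phi> (g x) - x)"
      by (intro continuous_intros continuous_on_compose2[OF \<phi>(1) g(1)]) auto
    then have "closedin (top_of_set J) {x \<in> J. \<phi> (g x) - x = 0}"
      by (rule continuous_closedin_preimage_constant)
    moreover have "{x \<in> J. \<phi> (g x) - x = 0} = range \<phi>"
      using \<phi>(2) g(2) by (auto simp: image_iff) metis
    ultimately show ?thesis by simp
  qed
  moreover have "connected J"
    using J by (simp add: open_interval_def is_interval_connected_1)
  ultimately show ?thesis unfolding connected_clopen by blast
qed

text \<open>
  The parameter of \<open>\<plusminus> e\<^sup>w (sinh \<phi>, cosh \<phi>)\<close>, as a function of the point.
\<close>

definition angle :: "real \<times> real \<Rightarrow> real" where
  "angle v = (ln \<bar>null_plus v\<bar> - ln \<bar>null_minus v\<bar>) / 2"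

lemma continuous_on_angle: "continuous_on cone_minus angle"
proof -
  have "null_plus v \<noteq> 0" "null_minus v \<noteq> 0" if "v \<in> cone_minus" for v
    using that by (auto simp: cone_minus_def lor_self_null)
  then show ?thesis
    unfolding angle_def[abs_def]
    by (intro continuous_intros bounded_linear.continuous_on[OF bounded_linear_null_plus]
        bounded_linear.continuous_on[OF bounded_linear_null_minus]) auto
qed

lemma profile_pos: "profile \<alpha> c s > 0"
  by (simp add: profile_eq_exp)

lemma null_plus_model_curve: "null_plus (model_curve \<alpha> c s) = profile \<alpha> c s * exp s"
  and null_minus_model_curve: "null_minus (model_curve \<alpha> c s) = - (profile \<alpha> c s * exp (- s))"
  by (simp_all add: null_plus_def null_minus_def model_curve_def sinh_plus_cosh sinh_minus_cosh
      flip: distrib_left right_diff_distrib)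

lemma angle_model_curve: "angle (model_curve \<alpha> c s) = s"
  by (simp add: angle_def null_plus_model_curve null_minus_model_curve abs_mult profile_pos
      less_imp_neq[symmetric] ln_mult)

text \<open>
  A stationary curve does not meet the light cone, so a curve \<open>\<delta>\<close> that contains the model stays in
  \<open>cone_minus\<close>, and the angle is defined and continuous along all of \<open>\<delta>\<close>. Along the model it equals
  the parameter, hence it inverts the change of parameter on the left.
\<close>

lemma maximal_stationary_model_curve:
  assumes "c\<^sup>2 < 1"
  shows "maximal_stationary \<alpha> (model_curve \<alpha> c) UNIV"
proof -
  have arc: "range \<phi> = J"
    if J: "open_interval J" and \<delta>: "stationary \<alpha> \<delta> J" and \<phi>: "regular_on \<phi> UNIV" "range \<phi> \<subseteq> J"
      and eq: "\<And>t. model_curve \<alpha> c t = \<delta> (\<phi> t)" for \<delta> J \<phi>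
  proof (rule range_eq_of_continuous_left_inverse[OF J _ \<phi>(2)])
    have cont: "continuous_on J \<delta>"
      using \<delta> smooth_on_continuous_on[of \<delta> J]
      by (auto simp: stationary_def spacelike_def timelike_def regular_on_def)
    have "\<delta> s \<in> cone_minus" if "s \<in> J" for s
    proof -
      have "sgn (lor (\<delta> s) (\<delta> s)) = sgn (lor (\<delta> (\<phi> 0)) (\<delta> (\<phi> 0)))"
      proof (rule sgn_eq_on_connected[of J "\<lambda>s. lor (\<delta> s) (\<delta> s)"])
        show "continuous_on J (\<lambda>s. lor (\<delta> s) (\<delta> s))"
          unfolding lor_def by (intro continuous_intros cont)
        show "lor (\<delta> s) (\<delta> s) \<noteq> 0" if "s \<in> J" for s
          using \<delta> that by (auto simp: stationary_def light_cone_def)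
      qed (use J that \<phi>(2) in \<open>auto simp: open_interval_def is_interval_connected_1\<close>)
      moreover have "lor (\<delta> (\<phi> 0)) (\<delta> (\<phi> 0)) < 0"
        using subsetD[OF spacelike_stationary_model_curve(2)[OF assms] rangeI, of \<alpha> 0] eq[of 0]
        by (simp add: cone_minus_def)
      ultimately show ?thesis
        by (simp add: cone_minus_def sgn_if split: if_splits)
    qed
    then show "continuous_on J (\<lambda>s. angle (\<delta> s))"
      by (intro continuous_on_compose2[OF continuous_on_angle cont]) auto
    show "angle (\<delta> (\<phi> t)) = t" for t
      using angle_model_curve[of \<alpha> c t] eq by simp
    show "continuous_on UNIV \<phi>"
      using \<phi>(1) by (simp add: regular_on_def smooth_on_continuous_on)
  qed
  show ?thesis
    unfolding maximal_stationary_def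
  proof (intro conjI allI impI spacelike_stationary_model_curve(3)[OF assms])
    fix \<delta> J \<phi>
    assume "open_interval J \<and> stationary \<alpha> \<delta> J \<and> regular_on \<phi> UNIV \<and> range \<phi> \<subseteq> J \<and>
      (\<forall>t\<in>UNIV. model_curve \<alpha> c t = \<delta> (\<phi> t))"
    then show "range \<phi> = J" by (intro arc[of J \<delta> \<phi>]) auto
  qed
qed

section \<open>Behaviour at the ends\<close>

lemma asymptotic_branchI:
  assumes "filterlim (\<lambda>s. snd (\<gamma> s)) at_top F"
    and "((\<lambda>s. snd (\<gamma> s) - \<sigma> * fst (\<gamma> s)) \<longlongrightarrow> b) F"
  shows "asymptotic_branch \<gamma> F {(x, y). y = \<sigma> * x + b}"
proof -
  let ?L = "{(x, y). y = \<sigma> * x + b}"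
  have "filterlim (\<lambda>s. norm (\<gamma> s)) at_top F"
  proof (rule filterlim_at_top_mono[OF assms(1)], intro always_eventually allI)
    show "snd (\<gamma> s) \<le> norm (\<gamma> s)" for s
      using norm_snd_le[of "snd (\<gamma> s)" "fst (\<gamma> s)"] by simp
  qed
  moreover have "((\<lambda>s. infdist (\<gamma> s) ?L) \<longlongrightarrow> 0) F"
  proof (rule real_tendsto_sandwich[OF _ _ tendsto_const])
    show "\<forall>\<^sub>F s in F. infdist (\<gamma> s) ?L \<le> \<bar>snd (\<gamma> s) - \<sigma> * fst (\<gamma> s) - b\<bar>"
    proof (intro always_eventually allI)
      fix s
      have "infdist (\<gamma> s) ?L \<le> dist (\<gamma> s) (fst (\<gamma> s), \<sigma> * fst (\<gamma> s) + b)"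
        by (rule infdist_le) simp
      also have "\<dots> = \<bar>snd (\<gamma> s) - \<sigma> * fst (\<gamma> s) - b\<bar>"
        by (cases "\<gamma> s") (simp add: dist_Pair_Pair dist_real_def)
      finally show "infdist (\<gamma> s) ?L \<le> \<bar>snd (\<gamma> s) - \<sigma> * fst (\<gamma> s) - b\<bar>" .
    qed
    show "((\<lambda>s. \<bar>snd (\<gamma> s) - \<sigma> * fst (\<gamma> s) - b\<bar>) \<longlongrightarrow> 0) F"
      using tendsto_rabs[OF tendsto_diff[OF assms(2) tendsto_const[of b]]] by simp
  qed (simp add: infdist_nonneg)
  ultimately show ?thesis by (simp add: asymptotic_branch_def)
qed

lemma exp_mult_at_top_0: "k < 0 \<Longrightarrow> ((\<lambda>s. exp (k * s)) \<longlongrightarrow> (0::real)) at_top"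
  by (rule filterlim_compose[OF exp_at_bot])
    (rule filterlim_tendsto_neg_mult_at_bot[OF tendsto_const _ filterlim_ident])

lemma exp_mult_at_top_infinity: "k > 0 \<Longrightarrow> filterlim (\<lambda>s. exp (k * s) :: real) at_top at_top"
  by (rule filterlim_compose[OF exp_at_top])
    (rule filterlim_tendsto_pos_mult_at_top[OF tendsto_const _ filterlim_ident])

lemma tanh_mult_at_top:
  fixes k :: real
  assumes "k \<noteq> 0"
  shows "((\<lambda>s. tanh (k * s)) \<longlongrightarrow> sgn k) at_top"
proof -
  have *: "((\<lambda>s. tanh (k * s)) \<longlongrightarrow> 1) at_top" if "k > 0" for k :: real
    using that by (intro filterlim_compose[OF tanh_real_at_top]
        filterlim_tendsto_pos_mult_at_top[OF tendsto_const _ filterlim_ident])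
  show ?thesis
  proof (cases "k > 0")
    case False
    then show ?thesis using tendsto_minus[OF *[of "- k"]] assms by simp
  qed (use * in simp)
qed

text \<open>
  For \<open>\<alpha> > 1\<close> this is the height of the vertex of the asymptotic cone; for \<open>\<alpha> < 1\<close> it is the absolute
  value of the nonzero null coordinate of the limit points on the light cone.
\<close>

definition null_limit :: "real \<Rightarrow> real" where
  "null_limit \<alpha> = (1 / 2) powr (1 / (\<alpha> - 1))"

lemma null_limit_pos: "null_limit \<alpha> > 0"
  by (simp add: null_limit_def)

lemma profile_even: "\<alpha> \<noteq> 1 \<Longrightarrow> profile \<alpha> c (- s) = profile \<alpha> c s"
  by (simp add: profile_def)

text \<open>
  The exponential enters the power as \<open>exp (- \<bar>m\<bar> s)\<close>, \<open>m = \<alpha> - 1\<close>, and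
  \<open>cosh (m s) exp (- \<bar>m\<bar> s) \<rightarrow> 1/2\<close>.
\<close>

lemma profile_null_limit:
  assumes "\<alpha> \<noteq> 1"
  shows "((\<lambda>s. profile \<alpha> c s * exp (- sgn (\<alpha> - 1) * s)) \<longlongrightarrow> null_limit \<alpha>) at_top"
proof -
  define m where "m = \<alpha> - 1"
  have m: "m \<noteq> 0" using assms by (simp add: m_def)
  have "((\<lambda>s. (1 + exp (- 2 * \<bar>m\<bar> * s)) / 2) \<longlongrightarrow> (1 + 0) / 2) at_top"
    using m by (intro tendsto_intros exp_mult_at_top_0) auto
  then have "((\<lambda>s. ((1 + exp (- 2 * \<bar>m\<bar> * s)) / 2) powr (1 / m)) \<longlongrightarrow> (1 / 2) powr (1 / m)) at_top"
    by (intro tendsto_powr tendsto_const) auto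
  moreover have "profile \<alpha> c s * exp (- sgn m * s) = ((1 + exp (- 2 * \<bar>m\<bar> * s)) / 2) powr (1 / m)" for s
  proof -
    have "exp (- sgn m * s) = exp (- \<bar>m\<bar> * s) powr (1 / m)"
      using m by (simp add: powr_def abs_sgn field_simps sgn_if)
    then have "profile \<alpha> c s * exp (- sgn m * s) = (cosh (m * s) * exp (- \<bar>m\<bar> * s)) powr (1 / m)"
      using assms by (simp add: profile_def m_def powr_mult)
    also have "cosh (m * s) * exp (- \<bar>m\<bar> * s) = (1 + exp (- 2 * \<bar>m\<bar> * s)) / 2"
      by (simp add: cosh_def field_simps abs_if flip: exp_add)
    finally show ?thesis .
  qed
  ultimately show ?thesis by (simp add: null_limit_def m_def)
qed

text \<open>
  On the branch \<open>s \<rightarrow> \<infinity>\<close> the height above the line \<open>y = x\<close> is \<open>\<rho>(s) exp (- s)\<close>; the other branch is its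
  mirror image because the profile is even. Since \<open>\<rho> \<ge> 1\<close>, the curve leaves every bounded set.
\<close>

lemma model_curve_asymptotic_to_cone:
  assumes "\<alpha> > 1"
  shows "asymptotic_to_cone (model_curve \<alpha> c) (null_limit \<alpha>)"
proof -
  have lim: "((\<lambda>s. profile \<alpha> c s * exp (- s)) \<longlongrightarrow> null_limit \<alpha>) at_top"
    using profile_null_limit[of \<alpha> c] assms by simp
  have snd_ge: "cosh s \<le> snd (model_curve \<alpha> c s)" for s
  proof -
    have "1 \<le> profile \<alpha> c s"
      using assms ge_one_powr_ge_zero[OF cosh_real_ge_1] by (simp add: profile_def)
    then show ?thesis
      using mult_right_mono[of 1 "profile \<alpha> c s" "cosh s"] cosh_real_ge_1[of s]
      by (simp add: model_curve_def)
  qed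
  have "asymptotic_branch (model_curve \<alpha> c) at_top {(x, y). y = 1 * x + null_limit \<alpha>}"
  proof (rule asymptotic_branchI)
    show "filterlim (\<lambda>s. snd (model_curve \<alpha> c s)) at_top at_top"
      by (rule filterlim_at_top_mono[OF cosh_real_at_top]) (simp add: snd_ge)
    have "snd (model_curve \<alpha> c s) - 1 * fst (model_curve \<alpha> c s) = profile \<alpha> c s * exp (- s)" for s
      using null_minus_model_curve[of \<alpha> c s] by (simp add: null_minus_def)
    then show "((\<lambda>s. snd (model_curve \<alpha> c s) - 1 * fst (model_curve \<alpha> c s)) \<longlongrightarrow> null_limit \<alpha>) at_top"
      using lim by simp
  qed
  moreover have "asymptotic_branch (model_curve \<alpha> c) at_bot {(x, y). y = - 1 * x + null_limit \<alpha>}"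
  proof (rule asymptotic_branchI)
    show "filterlim (\<lambda>s. snd (model_curve \<alpha> c s)) at_top at_bot"
      by (rule filterlim_at_top_mono[OF cosh_real_at_bot]) (simp add: snd_ge)
    have "snd (model_curve \<alpha> c s) - - 1 * fst (model_curve \<alpha> c s) = profile \<alpha> c s * exp s" for s
      using null_plus_model_curve[of \<alpha> c s] by (simp add: null_plus_def)
    then show "((\<lambda>s. snd (model_curve \<alpha> c s) - - 1 * fst (model_curve \<alpha> c s)) \<longlongrightarrow> null_limit \<alpha>) at_bot"
      using lim assms by (simp add: filterlim_at_bot_mirror profile_even)
  qed
  ultimately show ?thesis by (auto simp: asymptotic_to_cone_def)
qed

text \<open>
  Here the null coordinates are the exponentials \<open>exp ((c + 1) s)\<close> and \<open>- exp ((c - 1) s)\<close>: at each end one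
  tends to zero and the other one is unbounded.
\<close>

lemma model_curve_1_asymptotic_to_cone:
  assumes "c\<^sup>2 < 1"
  shows "asymptotic_to_cone (model_curve 1 c) 0"
proof -
  have c: "- 1 < c" "c < 1" using assms by (auto simp: abs_square_less_1 abs_less_iff)
  have np: "fst (model_curve 1 c s) + snd (model_curve 1 c s) = exp ((c + 1) * s)" for s
    using null_plus_model_curve[of 1 c s]
    by (simp add: null_plus_def profile_def algebra_simps flip: exp_add)
  have nm: "snd (model_curve 1 c s) - fst (model_curve 1 c s) = exp ((c - 1) * s)" for s
    using null_minus_model_curve[of 1 c s]
    by (simp add: null_minus_def profile_def algebra_simps flip: exp_add)
  have snd: "snd (model_curve 1 c s) = (exp ((c + 1) * s) + exp ((c - 1) * s)) / 2" for s
    using np[of s] nm[of s] by simp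
  have "asymptotic_branch (model_curve 1 c) at_top {(x, y). y = 1 * x + 0}"
  proof (rule asymptotic_branchI)
    have "filterlim (\<lambda>s. exp ((c + 1) * s) + exp ((c - 1) * s)) at_top at_top"
      using c by (intro filterlim_at_top_mono[OF exp_mult_at_top_infinity[of "c + 1"]]) auto
    then have "filterlim (\<lambda>s. (1 / 2) * (exp ((c + 1) * s) + exp ((c - 1) * s))) at_top at_top"
      by (intro filterlim_tendsto_pos_mult_at_top[OF tendsto_const]) auto
    then show "filterlim (\<lambda>s. snd (model_curve 1 c s)) at_top at_top" by (simp add: snd)
    show "((\<lambda>s. snd (model_curve 1 c s) - 1 * fst (model_curve 1 c s)) \<longlongrightarrow> 0) at_top"
      using c by (simp add: nm exp_mult_at_top_0)
  qed
  moreover have "asymptotic_branch (model_curve 1 c) at_bot {(x, y). y = - 1 * x + 0}"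
  proof (rule asymptotic_branchI)
    have "filterlim (\<lambda>s. exp ((- c - 1) * s) + exp ((1 - c) * s)) at_top at_top"
      using c by (intro filterlim_at_top_mono[OF exp_mult_at_top_infinity[of "1 - c"]]) auto
    then have "filterlim (\<lambda>s. (1 / 2) * (exp ((- c - 1) * s) + exp ((1 - c) * s))) at_top at_top"
      by (intro filterlim_tendsto_pos_mult_at_top[OF tendsto_const]) auto
    moreover have "(c + 1) * - s = (- c - 1) * s" "(c - 1) * - s = (1 - c) * s" for s
      by (simp_all add: algebra_simps)
    then have "snd (model_curve 1 c (- s)) = (1 / 2) * (exp ((- c - 1) * s) + exp ((1 - c) * s))" for s
      unfolding snd by simp
    ultimately show "filterlim (\<lambda>s. snd (model_curve 1 c s)) at_top at_bot"
      by (simp only: filterlim_at_bot_mirror)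
    have "((\<lambda>s. exp ((- c - 1) * s)) \<longlongrightarrow> 0) at_top"
      using c by (intro exp_mult_at_top_0) simp
    moreover have "snd (model_curve 1 c (- s)) - - 1 * fst (model_curve 1 c (- s)) = exp ((- c - 1) * s)" for s
    proof -
      have "(c + 1) * - s = (- c - 1) * s" by (simp add: algebra_simps)
      then show ?thesis using np[of "- s"] by (simp only: mult_minus1 diff_minus_eq_add add.commute)
    qed
    ultimately show "((\<lambda>s. snd (model_curve 1 c s) - - 1 * fst (model_curve 1 c s)) \<longlongrightarrow> 0) at_bot"
      by (simp only: filterlim_at_bot_mirror)
  qed
  ultimately show ?thesis by (auto simp: asymptotic_to_cone_def)
qed

text \<open>
  The branch is a whole component because a connected set on which \<open>y\<close> changes sign would contain a
  point with \<open>y = 0\<close>, where \<open>x\<^sup>2 - y\<^sup>2\<close> is nonnegative.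
\<close>

lemma hyperbolic_circle_model_curve: "hyperbolic_circle 1 (range (model_curve 1 0))"
proof -
  let ?S = "{p. lor p p = - (1::real)\<^sup>2}"
  have model: "model_curve 1 0 s = (sinh s, cosh s)" for s
    by (simp add: model_curve_def profile_def)
  have "connected (range (model_curve 1 0))"
    unfolding model by (intro connected_continuous_image continuous_intros) auto
  moreover have "range (model_curve 1 0) \<subseteq> ?S"
    by (auto simp: model lor_def cosh_square_eq simp flip: power2_eq_square)
  moreover have max: "D \<subseteq> range (model_curve 1 0)"
    if D: "range (model_curve 1 0) \<subseteq> D" "D \<subseteq> ?S" "connected D" for D
  proof
    fix v assume v: "v \<in> D"
    have pos: "snd v > 0"
    proof (rule ccontr)
      assume "\<not> snd v > 0"
      moreover have "(0, 1) \<in> D" using D(1) rangeI[of "model_curve 1 0" 0] by (auto simp: model)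
      moreover have "connected (snd ` D)"
        using D(3) by (intro connected_continuous_image continuous_intros)
      ultimately have "0 \<in> snd ` D"
        using v connectedD_interval[of "snd ` D" "snd v" 1 0] by force
      then obtain x where "(x, 0) \<in> D" by force
      then have "x * x = - 1" using D(2) by (auto simp: lor_def)
      then show False using zero_le_square[of x] by linarith
    qed
    obtain x y where xy: "v = (x, y)" by fastforce
    have "x * x - y * y = - 1" using D(2) v by (auto simp: xy lor_def)
    then have "y\<^sup>2 = (cosh (arsinh x))\<^sup>2"
      by (simp add: cosh_square_eq) (simp add: power2_eq_square)
    then have "y = cosh (arsinh x)"
      using pos xy by (simp add: power2_eq_iff_nonneg)
    then have "v = model_curve 1 0 (arsinh x)" by (simp add: xy model)
    then show "v \<in> range (model_curve 1 0)" by blast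
  qed
  ultimately have "range (model_curve 1 0) \<in> components ?S"
    unfolding in_components_maximal
    by (intro conjI allI impI equalityI) (simp_all add: max)
  then show ?thesis by (simp add: hyperbolic_circle_def)
qed

lemma model_curve_tendsto_cone:
  assumes "\<alpha> < 1"
  shows "(model_curve \<alpha> c \<longlongrightarrow> (null_limit \<alpha> / 2) *\<^sub>R (1, 1)) at_top"
    and "(model_curve \<alpha> c \<longlongrightarrow> (null_limit \<alpha> / 2) *\<^sub>R (- 1, 1)) at_bot"
proof -
  have lim: "((\<lambda>s. profile \<alpha> c s * exp s) \<longlongrightarrow> null_limit \<alpha>) at_top"
    using profile_null_limit[of \<alpha> c] assms by simp
  have exp0: "((\<lambda>s. exp (- 2 * s)) \<longlongrightarrow> (0::real)) at_top" by (rule exp_mult_at_top_0) simp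
  have eq: "model_curve \<alpha> c s =
      (profile \<alpha> c s * exp s) *\<^sub>R ((1 - exp (- 2 * s)) / 2, (1 + exp (- 2 * s)) / 2)" for s
    by (simp add: model_curve_def sinh_def cosh_def field_simps flip: exp_add)
  have "((\<lambda>s. (profile \<alpha> c s * exp s) *\<^sub>R ((1 - exp (- 2 * s)) / 2, (1 + exp (- 2 * s)) / 2))
      \<longlongrightarrow> null_limit \<alpha> *\<^sub>R ((1 - 0) / 2, (1 + 0) / 2)) at_top"
    by (intro tendsto_intros lim exp0) auto
  then show top: "(model_curve \<alpha> c \<longlongrightarrow> (null_limit \<alpha> / 2) *\<^sub>R (1, 1)) at_top"
    by (simp add: eq[abs_def])
  have "model_curve \<alpha> c (- s) = (- fst (model_curve \<alpha> c s), snd (model_curve \<alpha> c s))" for s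
    using assms by (simp add: model_curve_def profile_even)
  moreover have "((\<lambda>s. (- fst (model_curve \<alpha> c s), snd (model_curve \<alpha> c s))) \<longlongrightarrow>
      (- fst ((null_limit \<alpha> / 2) *\<^sub>R (1::real, 1::real)), snd ((null_limit \<alpha> / 2) *\<^sub>R (1::real, 1::real)))) at_top"
    by (intro tendsto_intros top)
  ultimately show "(model_curve \<alpha> c \<longlongrightarrow> (null_limit \<alpha> / 2) *\<^sub>R (- 1, 1)) at_bot"
    by (simp add: filterlim_at_bot_mirror)
qed

text \<open>
  The velocity is \<open>\<rho> (u sinh s + cosh s, u cosh s + sinh s)\<close> with \<open>u = tanh ((\<alpha> - 1) s)\<close>; multiplied by
  \<open>cosh ((\<alpha> - 1) s)\<close>, its entries are the addition formulas for \<open>(\<alpha> - 1) s + s\<close>.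
\<close>

lemma vderiv_model_curve_cosh_sinh:
  assumes "c\<^sup>2 < 1" "\<alpha> \<noteq> 1"
  shows "vderiv (model_curve \<alpha> c) s =
    (profile \<alpha> c s / cosh ((\<alpha> - 1) * s)) *\<^sub>R (cosh (\<alpha> * s), sinh (\<alpha> * s))"
proof -
  define m where "m = (\<alpha> - 1) * s"
  have "\<alpha> * s = m + s" by (simp add: m_def algebra_simps)
  moreover have "cosh m \<noteq> 0" by simp
  ultimately show ?thesis
    unfolding vderiv_model_curve[OF assms(1)] using assms(2)
    by (simp add: slope_def tanh_def sinh_add cosh_add field_simps flip: m_def)
qed

text \<open>
  The unit tangent has the direction of \<open>(1, tanh (\<alpha> s))\<close>, which has a nonzero limit.
\<close>

lemma limit_tangent_model_curve:
  assumes "c\<^sup>2 < 1" "\<alpha> \<noteq> 1" "((\<lambda>s. tanh (\<alpha> * s)) \<longlongrightarrow> l) F"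
  shows "limit_tangent (model_curve \<alpha> c) F (sgn (1, l))"
proof -
  have "sgn (vderiv (model_curve \<alpha> c) s) = sgn (1, tanh (\<alpha> * s))" for s
  proof -
    define k where "k = profile \<alpha> c s / cosh ((\<alpha> - 1) * s) * cosh (\<alpha> * s)"
    have "k > 0" by (simp add: k_def profile_pos cosh_real_pos)
    moreover have "vderiv (model_curve \<alpha> c) s = k *\<^sub>R (1, tanh (\<alpha> * s))"
      by (simp add: vderiv_model_curve_cosh_sinh[OF assms(1,2)] k_def tanh_def)
    ultimately show ?thesis by (simp only: sgn_scaleR sgn_pos scaleR_one)
  qed
  moreover have "((\<lambda>s. sgn (1::real, tanh (\<alpha> * s))) \<longlongrightarrow> sgn (1, l)) F"
    by (intro tendsto_intros assms(3)) (simp add: zero_prod_def)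
  ultimately show ?thesis
    by (simp add: limit_tangent_def norm_sgn zero_prod_def)
qed

lemma sgn_in_span: "k \<noteq> 0 \<Longrightarrow> sgn v \<in> span {k *\<^sub>R v}"
  for v :: "'a::real_normed_vector"
  by (auto simp: span_singleton sgn_div_norm image_iff intro!: exI[of _ "inverse (norm v) / k"])

lemma sgn_orthogonal_span: "v \<bullet> p = 0 \<Longrightarrow> w \<in> span {p} \<Longrightarrow> sgn v \<bullet> w = 0"
  for v :: "'a::real_inner"
  by (auto simp: span_singleton sgn_div_norm)

text \<open>
  The limit directions are \<open>(1, \<plusminus> sgn \<alpha>)\<close> and the limit points lie on the diagonals: a positive \<open>\<alpha>\<close>
  puts the tangent on the diagonal of the limit point, a negative one on the other diagonal.
\<close>

lemma model_curve_meets_cone: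
  assumes "c\<^sup>2 < 1" "\<alpha> < 1" "\<alpha> \<noteq> 0"
  defines "p \<equiv> (null_limit \<alpha> / 2) *\<^sub>R (- 1, 1)" and "q \<equiv> (null_limit \<alpha> / 2) *\<^sub>R (1, 1)"
  shows "p \<noteq> q"
    and "meets_cone_at (model_curve \<alpha> c) at_bot p" "meets_cone_at (model_curve \<alpha> c) at_top q"
    and "limit_tangent (model_curve \<alpha> c) at_bot (sgn (1, - sgn \<alpha>))"
    and "limit_tangent (model_curve \<alpha> c) at_top (sgn (1, sgn \<alpha>))"
proof -
  show "p \<noteq> q"
    "meets_cone_at (model_curve \<alpha> c) at_bot p" "meets_cone_at (model_curve \<alpha> c) at_top q"
    using null_limit_pos[of \<alpha>] model_curve_tendsto_cone[OF assms(2), of c]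
    by (auto simp: p_def q_def meets_cone_at_def light_cone_def lor_def zero_prod_def)
  have "((\<lambda>s. tanh (\<alpha> * s)) \<longlongrightarrow> - sgn \<alpha>) at_bot"
    using tendsto_minus[OF tanh_mult_at_top[OF assms(3)]] by (simp add: filterlim_at_bot_mirror)
  then show "limit_tangent (model_curve \<alpha> c) at_bot (sgn (1, - sgn \<alpha>))"
    "limit_tangent (model_curve \<alpha> c) at_top (sgn (1, sgn \<alpha>))"
    using assms tanh_mult_at_top[OF assms(3)] by (auto intro!: limit_tangent_model_curve)
qed

lemma model_curve_meets_cone_tangentially:
  assumes "c\<^sup>2 < 1" "0 < \<alpha>" "\<alpha> < 1"
  shows "\<exists>p q. p \<noteq> q \<and>
    meets_cone_tangentially_at (model_curve \<alpha> c) at_bot p \<and>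
    meets_cone_tangentially_at (model_curve \<alpha> c) at_top q"
proof -
  let ?p = "(null_limit \<alpha> / 2) *\<^sub>R (- 1, 1) :: real \<times> real"
  let ?q = "(null_limit \<alpha> / 2) *\<^sub>R (1, 1) :: real \<times> real"
  have p: "?p = (- null_limit \<alpha> / 2) *\<^sub>R (1, - 1)" by simp
  have "sgn (1, - 1) \<in> span {?p}" "sgn (1, 1) \<in> span {?q}"
    unfolding p using null_limit_pos[of \<alpha>] by (intro sgn_in_span; simp)+
  then have "?p \<noteq> ?q \<and> meets_cone_tangentially_at (model_curve \<alpha> c) at_bot ?p \<and>
      meets_cone_tangentially_at (model_curve \<alpha> c) at_top ?q"
    using model_curve_meets_cone[OF assms(1,3)] assms(2)
    unfolding meets_cone_tangentially_at_def
    by (auto simp del: split_paired_Ex split_paired_All)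
  then show ?thesis by blast
qed

lemma model_curve_meets_cone_orthogonally:
  assumes "c\<^sup>2 < 1" "\<alpha> < 0"
  shows "\<exists>p q. p \<noteq> q \<and>
    meets_cone_orthogonally_at (model_curve \<alpha> c) at_bot p \<and>
    meets_cone_orthogonally_at (model_curve \<alpha> c) at_top q"
proof -
  let ?p = "(null_limit \<alpha> / 2) *\<^sub>R (- 1, 1) :: real \<times> real"
  let ?q = "(null_limit \<alpha> / 2) *\<^sub>R (1, 1) :: real \<times> real"
  have "\<forall>w\<in>span {?p}. sgn (1, 1) \<bullet> w = 0" "\<forall>w\<in>span {?q}. sgn (1, - 1) \<bullet> w = 0"
    by (intro ballI sgn_orthogonal_span; simp)+
  then have "?p \<noteq> ?q \<and> meets_cone_orthogonally_at (model_curve \<alpha> c) at_bot ?p \<and>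
      meets_cone_orthogonally_at (model_curve \<alpha> c) at_top ?q"
    using model_curve_meets_cone[OF assms(1), of \<alpha>] assms(2)
    unfolding meets_cone_orthogonally_at_def
    by (auto simp del: split_paired_Ex split_paired_All)
  then show ?thesis by blast
qed

section \<open>The classification theorem\<close>

theorem theorem4p1:
  fixes \<alpha> :: real
  shows
    "(\<forall>c. c\<^sup>2 < 1 \<longrightarrow>
        maximal_stationary \<alpha> (model_curve \<alpha> c) UNIV \<and>
        spacelike (model_curve \<alpha> c) UNIV \<and>
        range (model_curve \<alpha> c) \<subseteq> cone_minus)
     \<and> (\<forall>\<delta> I. open_interval I \<and> stationary \<alpha> \<delta> I \<and> spacelike \<delta> I \<and> \<delta> ` I \<subseteq> cone_minus \<longrightarrow>
        (\<exists>c A r \<phi>. c\<^sup>2 < 1 \<and> linear_isometry A \<and> r > 0 \<and> regular_on \<phi> I \<and>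
           (\<forall>t\<in>I. \<delta> t = r *\<^sub>R A (model_curve \<alpha> c (\<phi> t))) \<and>
           (maximal_stationary \<alpha> \<delta> I \<longrightarrow> \<phi> ` I = UNIV)))
     \<and> (\<forall>c. c\<^sup>2 < 1 \<longrightarrow>
        (\<alpha> > 1 \<longrightarrow> (\<exists>b. b \<noteq> 0 \<and> asymptotic_to_cone (model_curve \<alpha> c) b)) \<and>
        (\<alpha> = 1 \<longrightarrow>
           (c = 0 \<and> (\<exists>r. hyperbolic_circle r (range (model_curve \<alpha> c)))) \<or>
           (c \<noteq> 0 \<and> asymptotic_to_cone (model_curve \<alpha> c) 0)) \<and>
        (0 < \<alpha> \<and> \<alpha> < 1 \<longrightarrow>
           (\<exists>p q. p \<noteq> q \<and>
              meets_cone_tangentially_at (model_curve \<alpha> c) at_bot p \<and>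
              meets_cone_tangentially_at (model_curve \<alpha> c) at_top q)) \<and>
        (\<alpha> < 0 \<longrightarrow>
           (\<exists>p q. p \<noteq> q \<and>
              meets_cone_orthogonally_at (model_curve \<alpha> c) at_bot p \<and>
              meets_cone_orthogonally_at (model_curve \<alpha> c) at_top q)))"
proof (intro conjI allI impI)
  fix c :: real assume c: "c\<^sup>2 < 1"
  show "maximal_stationary \<alpha> (model_curve \<alpha> c) UNIV" "spacelike (model_curve \<alpha> c) UNIV"
    "range (model_curve \<alpha> c) \<subseteq> cone_minus"
    using maximal_stationary_model_curve[OF c] spacelike_stationary_model_curve[OF c] by blast+
  show "\<exists>b. b \<noteq> 0 \<and> asymptotic_to_cone (model_curve \<alpha> c) b" if "\<alpha> > 1"
    using model_curve_asymptotic_to_cone[OF that] null_limit_pos[of \<alpha>] by (metis less_irrefl)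
  show "(c = 0 \<and> (\<exists>r. hyperbolic_circle r (range (model_curve \<alpha> c)))) \<or>
      (c \<noteq> 0 \<and> asymptotic_to_cone (model_curve \<alpha> c) 0)" if "\<alpha> = 1"
    using hyperbolic_circle_model_curve model_curve_1_asymptotic_to_cone[OF c] that by blast
  show "\<exists>p q. p \<noteq> q \<and> meets_cone_tangentially_at (model_curve \<alpha> c) at_bot p \<and>
      meets_cone_tangentially_at (model_curve \<alpha> c) at_top q" if "0 < \<alpha> \<and> \<alpha> < 1"
    using model_curve_meets_cone_tangentially[OF c] that by blast
  show "\<exists>p q. p \<noteq> q \<and> meets_cone_orthogonally_at (model_curve \<alpha> c) at_bot p \<and>
      meets_cone_orthogonally_at (model_curve \<alpha> c) at_top q" if "\<alpha> < 0"
    using model_curve_meets_cone_orthogonally[OF c that] .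
next
  fix \<delta> :: "real \<Rightarrow> real \<times> real" and I
  assume "open_interval I \<and> stationary \<alpha> \<delta> I \<and> spacelike \<delta> I \<and> \<delta> ` I \<subseteq> cone_minus"
  then show "\<exists>c A r \<phi>. c\<^sup>2 < 1 \<and> linear_isometry A \<and> r > 0 \<and> regular_on \<phi> I \<and>
      (\<forall>t\<in>I. \<delta> t = r *\<^sub>R A (model_curve \<alpha> c (\<phi> t))) \<and>
      (maximal_stationary \<alpha> \<delta> I \<longrightarrow> \<phi> ` I = UNIV)"
    by (elim conjE) (rule spacelike_stationary_is_scaled_model)
qed

end
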